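(* Let $S$ be a complex abelian variety with polarization $L$, and let $u\in\mathrm{End}(S)$ satisfy $\varphi_L u=\hat u\varphi_L$ and $u^2=qu$ for a positive integer $q$. Let $A=\mathrm{im}(u)$ and $P=\mathrm{im}(q-u)$, with induced polarizations $L_A=L|A$ and $L_P=L|P$. (a) If $L_A=M^q$ for a polarization $M$ on $A$, then $K(M)=u(K(L))$ as subgroups of $A$. (b) If $L_P=N^q$ for a polarization $N$ on $P$, then $K(N)=(q-u)(K(L))$ as subgroups of $P$.
   Context: For a polarization $L$ on an abelian variety $S$, $\varphi_L:S\to\hat S$ is the associated isogeny to the dual abelian variety and $K(L)=\ker\varphi_L$. $\hat u\in\mathrm{End}(\hat S)$ is the dual of $u$. $q-u$ denotes $q\cdot\mathrm{id}_S-u$. Equality of polarizations is equality of classes up to algebraic equivalence. *)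

theory Defs
  imports "HOL-Analysis.Analysis" "HOL-Algebra.Coset" "HOL-Library.Function_Algebras"
begin

section \<open>Complex tori\<close>

text \<open>
  A complex torus \<open>V / \<Lambda>\<close> is given by the pair of \<open>V\<close> and \<open>\<Lambda>\<close>. The vector space \<open>V\<close> is an
  arbitrary complex subspace of an ambient \<open>\<complex>\<^sup>n\<close>, so that a torus and its subtori are objects of
  the same type.
\<close>

record 'a torus =
  tangent :: "'a set"
  lattice :: "'a set"

type_synonym 'n ctorus = "(complex ^ 'n) torus"

definition vector_group :: "'a::ab_group_add set \<Rightarrow> 'a monoid" where
  "vector_group V = \<lparr>carrier = V, mult = (+), one = 0\<rparr>"

definition complex_torus :: "'n::finite ctorus \<Rightarrow> bool" where
  "complex_torus S \<longleftrightarrow>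
     vec.subspace (tangent S) \<and>
     subgroup (lattice S) (vector_group (tangent S)) \<and>
     discrete (lattice S) \<and>
     span (lattice S) = tangent S"

definition points :: "'n::finite ctorus \<Rightarrow> (complex ^ 'n) set monoid" where
  "points S = vector_group (tangent S) Mod lattice S"

definition torus_proj :: "'n::finite ctorus \<Rightarrow> complex ^ 'n \<Rightarrow> (complex ^ 'n) set" where
  "torus_proj S v = lattice S #>\<^bsub>vector_group (tangent S)\<^esub> v"

text \<open>
  A map between two complex tori is holomorphic if it lifts, locally around every point, to a
  holomorphic map of the tangent spaces. The derivative \<open>D\<close> is only determined, hence only
  required to be complex linear, on \<open>tangent S\<close>.
\<close>

definition holomorphic_on_tangent ::
  "'n::finite ctorus \<Rightarrow> (complex ^ 'n) set \<Rightarrow> (complex ^ 'n \<Rightarrow> complex ^ 'm::finite) \<Rightarrow> bool" where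
  "holomorphic_on_tangent S W F \<longleftrightarrow>
     (\<forall>w \<in> W \<inter> tangent S. \<exists>D. (F has_derivative D) (at w within tangent S) \<and>
        (\<forall>c. \<forall>z \<in> tangent S. D (c *s z) = c *s D z))"

definition torus_holomorphic ::
  "'n::finite ctorus \<Rightarrow> 'm::finite ctorus \<Rightarrow> ((complex ^ 'n) set \<Rightarrow> (complex ^ 'm) set) \<Rightarrow> bool" where
  "torus_holomorphic S T f \<longleftrightarrow>
     (\<forall>v \<in> tangent S. \<exists>W F. open W \<and> v \<in> W \<and> holomorphic_on_tangent S W F \<and>
        (\<forall>w \<in> W \<inter> tangent S. F w \<in> tangent T \<and> f (torus_proj S w) = torus_proj T (F w)))"

definition torus_hom ::
  "'n::finite ctorus \<Rightarrow> 'm::finite ctorus \<Rightarrow> ((complex ^ 'n) set \<Rightarrow> (complex ^ 'm) set) set" where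
  "torus_hom S T = {f \<in> hom (points S) (points T). torus_holomorphic S T f}"

abbreviation torus_End :: "'n::finite ctorus \<Rightarrow> ((complex ^ 'n) set \<Rightarrow> (complex ^ 'n) set) set" where
  "torus_End S \<equiv> torus_hom S S"

text \<open>The endomorphism \<open>q - u\<close>, in the group of points.\<close>

definition nat_minus ::
  "'n::finite ctorus \<Rightarrow> nat \<Rightarrow> ((complex ^ 'n) set \<Rightarrow> (complex ^ 'n) set) \<Rightarrow>
     (complex ^ 'n) set \<Rightarrow> (complex ^ 'n) set" where
  "nat_minus S q u x = (x [^]\<^bsub>points S\<^esub> q) \<otimes>\<^bsub>points S\<^esub> (inv\<^bsub>points S\<^esub> (u x))"

text \<open>
  The analytic representation of a homomorphism of complex tori: its unique complex linear lift
  to the tangent spaces (extended by zero outside \<open>tangent S\<close>).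
\<close>

definition is_analytic_rep ::
  "'n::finite ctorus \<Rightarrow> 'm::finite ctorus \<Rightarrow> ((complex ^ 'n) set \<Rightarrow> (complex ^ 'm) set) \<Rightarrow>
     (complex ^ 'n \<Rightarrow> complex ^ 'm) \<Rightarrow> bool" where
  "is_analytic_rep S T f U \<longleftrightarrow>
     (\<forall>v. v \<notin> tangent S \<longrightarrow> U v = 0) \<and>
     (\<forall>v \<in> tangent S. \<forall>w \<in> tangent S. U (v + w) = U v + U w) \<and>
     (\<forall>c. \<forall>v \<in> tangent S. U (c *s v) = c *s U v) \<and>
     (\<forall>v \<in> tangent S. U v \<in> tangent T \<and> f (torus_proj S v) = torus_proj T (U v))"

definition analytic_rep ::
  "'n::finite ctorus \<Rightarrow> 'm::finite ctorus \<Rightarrow> ((complex ^ 'n) set \<Rightarrow> (complex ^ 'm) set) \<Rightarrow>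
     complex ^ 'n \<Rightarrow> complex ^ 'm" where
  "analytic_rep S T f = (THE U. is_analytic_rep S T f U)"

section \<open>Subtori\<close>

definition subtorus :: "'n::finite ctorus \<Rightarrow> 'n ctorus \<Rightarrow> bool" where
  "subtorus A S \<longleftrightarrow>
     complex_torus A \<and> tangent A \<subseteq> tangent S \<and> lattice A = lattice S \<inter> tangent A"

text \<open>The inclusion \<open>A \<rightarrow> S\<close>: it maps the coset \<open>v + lattice A\<close> to the coset \<open>v + lattice S\<close>.\<close>

definition torus_incl :: "'n::finite ctorus \<Rightarrow> (complex ^ 'n) set \<Rightarrow> (complex ^ 'n) set" where
  "torus_incl S x = lattice S <#>\<^bsub>vector_group (tangent S)\<^esub> x"

text \<open>
  \<open>A\<close> is the image of \<open>f : S \<rightarrow> S\<close>, i.e. it is the subtorus of \<open>S\<close> whose set of points is the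
  set-theoretic image of \<open>f\<close>. A subtorus is determined by its set of points.
\<close>

definition is_image_torus ::
  "'n::finite ctorus \<Rightarrow> 'n ctorus \<Rightarrow> ((complex ^ 'n) set \<Rightarrow> (complex ^ 'n) set) \<Rightarrow> bool" where
  "is_image_torus A S f \<longleftrightarrow>
     subtorus A S \<and> torus_incl S ` carrier (points A) = f ` carrier (points S)"

section \<open>Polarizations\<close>

text \<open>
  By the Appell-Humbert theorem, classes of line bundles on \<open>V / \<Lambda>\<close> up to algebraic equivalence
  are the Hermitian forms \<open>H\<close> on \<open>V\<close> (linear in the first, antilinear in the second argument)
  whose imaginary part is integral on \<open>\<Lambda>\<close>, the first Chern classes. A polarization is such a
  class with \<open>H\<close> positive definite. Forms are extended by zero outside \<open>V \<times> V\<close>, so that equality of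
  classes is equality of functions.
\<close>

definition polarization ::
  "'n::finite ctorus \<Rightarrow> (complex ^ 'n \<Rightarrow> complex ^ 'n \<Rightarrow> complex) \<Rightarrow> bool" where
  "polarization S H \<longleftrightarrow>
     (\<forall>v w. v \<notin> tangent S \<or> w \<notin> tangent S \<longrightarrow> H v w = 0) \<and>
     (\<forall>v \<in> tangent S. \<forall>v' \<in> tangent S. \<forall>w \<in> tangent S. H (v + v') w = H v w + H v' w) \<and>
     (\<forall>c. \<forall>v \<in> tangent S. \<forall>w \<in> tangent S. H (c *s v) w = c * H v w) \<and>
     (\<forall>v \<in> tangent S. \<forall>w \<in> tangent S. H w v = cnj (H v w)) \<and>
     (\<forall>v \<in> tangent S. v \<noteq> 0 \<longrightarrow> Re (H v v) > 0) \<and>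
     (\<forall>l \<in> lattice S. \<forall>m \<in> lattice S. Im (H l m) \<in> \<int>)"

definition abelian_variety :: "'n::finite ctorus \<Rightarrow> bool" where
  "abelian_variety S \<longleftrightarrow> complex_torus S \<and> (\<exists>H. polarization S H)"

definition pol_restrict ::
  "(complex ^ 'n \<Rightarrow> complex ^ 'n \<Rightarrow> complex) \<Rightarrow> 'n::finite ctorus \<Rightarrow>
     complex ^ 'n \<Rightarrow> complex ^ 'n \<Rightarrow> complex" where
  "pol_restrict H A = (\<lambda>v w. if v \<in> tangent A \<and> w \<in> tangent A then H v w else 0)"

text \<open>The class of the tensor power \<open>M\<^sup>q\<close>; the tensor product adds first Chern classes.\<close>

definition pol_power ::
  "(complex ^ 'n \<Rightarrow> complex ^ 'n \<Rightarrow> complex) \<Rightarrow> nat \<Rightarrow>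
     complex ^ 'n::finite \<Rightarrow> complex ^ 'n \<Rightarrow> complex" where
  "pol_power H q = (\<lambda>v w. of_nat q * H v w)"

section \<open>The dual torus\<close>

text \<open>
  The dual of \<open>V / \<Lambda>\<close> is the quotient of the space of antilinear functionals on \<open>V\<close> by the
  functionals whose imaginary part is integral on \<open>\<Lambda>\<close>. The class of \<open>l\<close> is the line bundle in
  \<open>Pic\<^sup>0\<close> given by the character \<open>exp (2 \<pi> i Im l)\<close> of \<open>\<Lambda>\<close>. As before, functionals vanish outside
  \<open>V\<close>.
\<close>

definition dual_tangent :: "'n::finite ctorus \<Rightarrow> (complex ^ 'n \<Rightarrow> complex) set" where
  "dual_tangent S = {l.
     (\<forall>v. v \<notin> tangent S \<longrightarrow> l v = 0) \<and>
     (\<forall>v \<in> tangent S. \<forall>w \<in> tangent S. l (v + w) = l v + l w) \<and>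
     (\<forall>c. \<forall>v \<in> tangent S. l (c *s v) = cnj c * l v)}"

definition dual_lattice :: "'n::finite ctorus \<Rightarrow> (complex ^ 'n \<Rightarrow> complex) set" where
  "dual_lattice S = {l \<in> dual_tangent S. \<forall>m \<in> lattice S. Im (l m) \<in> \<int>}"

definition dual_points :: "'n::finite ctorus \<Rightarrow> (complex ^ 'n \<Rightarrow> complex) set monoid" where
  "dual_points S = vector_group (dual_tangent S) Mod dual_lattice S"

definition dual_proj ::
  "'n::finite ctorus \<Rightarrow> (complex ^ 'n \<Rightarrow> complex) \<Rightarrow> (complex ^ 'n \<Rightarrow> complex) set" where
  "dual_proj S l = dual_lattice S #>\<^bsub>vector_group (dual_tangent S)\<^esub> l"

text \<open>
  The dual \<open>T^ \<rightarrow> S^\<close> of \<open>f : S \<rightarrow> T\<close> (pullback of line bundles) is induced by the transpose of the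
  analytic representation of \<open>f\<close>.
\<close>

definition dual_hom ::
  "'n::finite ctorus \<Rightarrow> 'm::finite ctorus \<Rightarrow> ((complex ^ 'n) set \<Rightarrow> (complex ^ 'm) set) \<Rightarrow>
     (complex ^ 'm \<Rightarrow> complex) set \<Rightarrow> (complex ^ 'n \<Rightarrow> complex) set" where
  "dual_hom S T f x = the_elem ((\<lambda>l. dual_proj S (l \<circ> analytic_rep S T f)) ` x)"

text \<open>
  The isogeny of a polarization with Hermitian form \<open>H\<close>: the bundle obtained from a point \<open>v\<close> by
  translating and dividing has the character \<open>exp (2 \<pi> i Im (H v \<cdot>))\<close>.
\<close>

definition phi ::
  "'n::finite ctorus \<Rightarrow> (complex ^ 'n \<Rightarrow> complex ^ 'n \<Rightarrow> complex) \<Rightarrow>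
     (complex ^ 'n) set \<Rightarrow> (complex ^ 'n \<Rightarrow> complex) set" where
  "phi S H x = the_elem ((\<lambda>v. dual_proj S (H v)) ` x)"

definition pol_kernel ::
  "'n::finite ctorus \<Rightarrow> (complex ^ 'n \<Rightarrow> complex ^ 'n \<Rightarrow> complex) \<Rightarrow> (complex ^ 'n) set set" where
  "pol_kernel S H = kernel (points S) (dual_points S) (phi S H)"

section \<open>Well-definedness\<close>

lemma vector_group_simps [simp]:
  "carrier (vector_group V) = V"
  "x \<otimes>\<^bsub>vector_group V\<^esub> y = x + y"
  "\<one>\<^bsub>vector_group V\<^esub> = 0"
  by (simp_all add: vector_group_def)

lemma torus_proj_eq: "torus_proj S v = (\<lambda>l. l + v) ` lattice S"
  by (auto simp: torus_proj_def r_coset_def)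

lemma dual_proj_eq: "dual_proj S v = (\<lambda>l. l + v) ` dual_lattice S"
  by (auto simp: dual_proj_def r_coset_def)

lemma comm_group_vector_group:
  assumes "0 \<in> V" "\<And>x y. x \<in> V \<Longrightarrow> y \<in> V \<Longrightarrow> x + y \<in> V" "\<And>x. x \<in> V \<Longrightarrow> - x \<in> V"
  shows "comm_group (vector_group V)"
  by (rule comm_groupI) (use assms in \<open>auto simp: add.assoc add.commute intro!: bexI[of _ "- _"]\<close>)

lemma tangent_closed:
  assumes "complex_torus S"
  shows "0 \<in> tangent S"
    and "x \<in> tangent S \<Longrightarrow> y \<in> tangent S \<Longrightarrow> x + y \<in> tangent S"
    and "x \<in> tangent S \<Longrightarrow> - x \<in> tangent S"
    and "x \<in> tangent S \<Longrightarrow> y \<in> tangent S \<Longrightarrow> x - y \<in> tangent S"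
    and "x \<in> tangent S \<Longrightarrow> c *s x \<in> tangent S"
  using assms unfolding complex_torus_def
  by (auto intro: vec.subspace_0 vec.subspace_add vec.subspace_neg vec.subspace_diff vec.subspace_scale)

lemma scaleR_eq_vector_smult: "r *\<^sub>R (x :: complex ^ 'n) = of_real r *s x"
  unfolding vec_eq_iff vector_scaleR_component vector_smult_component
  by (simp add: scaleR_conv_of_real)

lemma tangent_scaleR: "complex_torus S \<Longrightarrow> x \<in> tangent S \<Longrightarrow> r *\<^sub>R x \<in> tangent S"
  by (simp add: scaleR_eq_vector_smult tangent_closed)

lemma comm_group_tangent: "complex_torus S \<Longrightarrow> comm_group (vector_group (tangent S))"
  by (rule comm_group_vector_group) (auto intro: tangent_closed)

lemma lattice_normal: "complex_torus S \<Longrightarrow> lattice S \<lhd> vector_group (tangent S)"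
  using comm_group.normal_iff_subgroup[OF comm_group_tangent] by (auto simp: complex_torus_def)

lemma lattice_closed:
  assumes "complex_torus S"
  shows "0 \<in> lattice S"
    and "x \<in> lattice S \<Longrightarrow> y \<in> lattice S \<Longrightarrow> x + y \<in> lattice S"
    and "x \<in> lattice S \<Longrightarrow> - x \<in> lattice S"
    and "x \<in> lattice S \<Longrightarrow> y \<in> lattice S \<Longrightarrow> x - y \<in> lattice S"
    and "x \<in> lattice S \<Longrightarrow> x \<in> tangent S"
proof -
  interpret G: comm_group "vector_group (tangent S)" using assms by (rule comm_group_tangent)
  interpret H: subgroup "lattice S" "vector_group (tangent S)"
    using assms by (simp add: complex_torus_def)
  show 0: "0 \<in> lattice S" using H.one_closed by simp
  show add: "x \<in> lattice S \<Longrightarrow> y \<in> lattice S \<Longrightarrow> x + y \<in> lattice S" for x y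
    using H.m_closed[of x y] by simp
  show tan: "x \<in> lattice S \<Longrightarrow> x \<in> tangent S" for x using H.subset by auto
  show neg: "- x \<in> lattice S" if "x \<in> lattice S" for x
  proof -
    have "inv\<^bsub>vector_group (tangent S)\<^esub> x = - x"
      by (rule G.inv_equality) (use that tan tangent_closed[OF assms] in auto)
    then show ?thesis using H.m_inv_closed[OF that] by simp
  qed
  show "x \<in> lattice S \<Longrightarrow> y \<in> lattice S \<Longrightarrow> x - y \<in> lattice S"
    using add[OF _ neg, of x y] by simp
qed

lemma torus_proj_eq_iff:
  assumes "complex_torus S"
  shows "torus_proj S v = torus_proj S w \<longleftrightarrow> v - w \<in> lattice S"
proof
  assume "torus_proj S v = torus_proj S w"
  moreover have "v \<in> torus_proj S v"
    using lattice_closed(1)[OF assms] by (force simp: torus_proj_eq)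
  ultimately show "v - w \<in> lattice S" by (auto simp: torus_proj_eq)
next
  assume *: "v - w \<in> lattice S"
  show "torus_proj S v = torus_proj S w"
    unfolding torus_proj_eq
  proof (intro subset_antisym subsetI; elim imageE)
    fix x l assume "x = l + v" "l \<in> lattice S"
    then show "x \<in> (\<lambda>l. l + w) ` lattice S"
      using lattice_closed(2)[OF assms _ *] by (intro image_eqI[of _ _ "l + (v - w)"]) auto
  next
    fix x l assume "x = l + w" "l \<in> lattice S"
    then show "x \<in> (\<lambda>l. l + v) ` lattice S"
      using lattice_closed(4)[OF assms _ *] by (intro image_eqI[of _ _ "l - (v - w)"]) auto
  qed
qed

lemma carrier_points: "carrier (points S) = torus_proj S ` tangent S"
  by (simp add: points_def carrier_FactGroup torus_proj_def[abs_def])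

lemma points_mult:
  assumes "complex_torus S" "v \<in> tangent S" "w \<in> tangent S"
  shows "torus_proj S v \<otimes>\<^bsub>points S\<^esub> torus_proj S w = torus_proj S (v + w)"
  using normal.rcos_sum[OF lattice_normal[OF assms(1)], of v w] assms
  by (simp add: points_def torus_proj_def)

lemma lattice_separated:
  assumes "complex_torus S"
  obtains e where "e > 0" "\<And>x. x \<in> lattice S \<Longrightarrow> norm x < e \<Longrightarrow> x = 0"
proof -
  have "0 isolated_in lattice S"
    using assms lattice_closed(1)[OF assms] by (auto simp: complex_torus_def discrete_def)
  then show ?thesis by (auto elim!: isolated_inE_dist intro!: that)
qed

lemma is_analytic_rep_unique:
  assumes S: "complex_torus S" and T: "complex_torus T"
    and U: "is_analytic_rep S T f U" and U': "is_analytic_rep S T f U'"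
  shows "U = U'"
proof
  fix v
  show "U v = U' v"
  proof (cases "v \<in> tangent S")
    case False
    then show ?thesis using U U' by (simp add: is_analytic_rep_def)
  next
    case True
    define d where "d = U v - U' v"
    have lat: "r *\<^sub>R d \<in> lattice T" for r
    proof -
      have "r *\<^sub>R v \<in> tangent S" using True S by (rule tangent_scaleR[rotated])
      moreover have "U (r *\<^sub>R v) = r *\<^sub>R U v" "U' (r *\<^sub>R v) = r *\<^sub>R U' v"
        using U U' True by (simp_all add: is_analytic_rep_def scaleR_eq_vector_smult)
      ultimately have "torus_proj T (r *\<^sub>R U v) = torus_proj T (r *\<^sub>R U' v)"
        using U U' unfolding is_analytic_rep_def by metis
      then show ?thesis by (simp add: torus_proj_eq_iff[OF T] d_def scaleR_diff_right)
    qed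
    obtain e where e: "e > 0" "\<And>x. x \<in> lattice T \<Longrightarrow> norm x < e \<Longrightarrow> x = 0"
      using lattice_separated[OF T] by blast
    have "d = 0"
    proof (rule ccontr)
      assume "d \<noteq> 0"
      define r where "r = e / (2 * norm d)"
      have "r *\<^sub>R d = 0" by (rule e(2)[OF lat]) (use \<open>d \<noteq> 0\<close> e(1) in \<open>simp add: r_def\<close>)
      then show False using \<open>d \<noteq> 0\<close> e(1) by (simp add: r_def)
    qed
    then show ?thesis by (simp add: d_def)
  qed
qed

lemma is_analytic_rep_exists:
  assumes S: "complex_torus S" and T: "complex_torus T" and f: "f \<in> torus_hom S T"
  shows "\<exists>U. is_analytic_rep S T f U"
proof -
  have f_hom: "f (torus_proj S (v + w)) = f (torus_proj S v) \<otimes>\<^bsub>points T\<^esub> f (torus_proj S w)"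
    if "v \<in> tangent S" "w \<in> tangent S" for v w
    unfolding points_mult[OF S that, symmetric]
    by (rule hom_mult[of f "points S" "points T"]) (use f that in \<open>auto simp: torus_hom_def carrier_points\<close>)
  have "torus_holomorphic S T f" using f by (simp add: torus_hom_def)
  from this[unfolded torus_holomorphic_def, rule_format, OF tangent_closed(1)[OF S]]
  obtain W F where W: "open W" "0 \<in> W" "holomorphic_on_tangent S W F"
    and F': "\<forall>w \<in> W \<inter> tangent S. F w \<in> tangent T \<and> f (torus_proj S w) = torus_proj T (F w)"
    by (elim exE conjE)
  have F: "F w \<in> tangent T \<and> f (torus_proj S w) = torus_proj T (F w)"
    if "w \<in> W" "w \<in> tangent S" for w
    using F' that by simp
  obtain D where D: "(F has_derivative D) (at 0 within tangent S)"
    and Dc: "\<And>c z. z \<in> tangent S \<Longrightarrow> D (c *s z) = c *s D z"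
    using W(2) tangent_closed(1)[OF S] W(3)[unfolded holomorphic_on_tangent_def, rule_format, of 0]
    by auto
  interpret D: bounded_linear D using D by (rule has_derivative_bounded_linear)
  obtain e where e: "e > 0" "\<And>x. x \<in> lattice T \<Longrightarrow> norm x < e \<Longrightarrow> x = 0"
    using lattice_separated[OF T] by blast
  define G where "G x = F x - F 0" for x
  have G_deriv: "(G has_derivative D) (at 0 within tangent S)"
    unfolding G_def using D by (auto intro!: derivative_eq_intros)
  have add_lat: "F (x + y) - (F x + F y) \<in> lattice T"
    if "x \<in> W" "y \<in> W" "x + y \<in> W" "x \<in> tangent S" "y \<in> tangent S" for x y
  proof -
    have "torus_proj T (F (x + y)) = torus_proj T (F x + F y)"
      using F[of x] F[of y] F[of "x + y"] f_hom[of x y] that tangent_closed(2)[OF S, of x y]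
        points_mult[OF T, of "F x" "F y"] by simp
    then show ?thesis by (simp add: torus_proj_eq_iff[OF T])
  qed
  have F0: "F 0 \<in> lattice T"
    using add_lat[of 0 0] W tangent_closed(1)[OF S] lattice_closed(3)[OF T] by force
  have "continuous (at 0 within tangent S) G" using G_deriv by (rule has_derivative_continuous)
  then obtain d1 where d1: "d1 > 0" "\<And>x. x \<in> tangent S \<Longrightarrow> norm x < d1 \<Longrightarrow> norm (G x) < e / 3"
    using e(1) unfolding continuous_within_eps_delta by (force simp: G_def dest: spec[of _ "e / 3"])
  obtain d2 where d2: "d2 > 0" "\<And>x. norm x < d2 \<Longrightarrow> x \<in> W"
    using W unfolding open_dist by force
  define d where "d = min d1 d2 / 2"
  have d: "d > 0" "2 * d \<le> d1" "2 * d \<le> d2" using d1 d2 by (auto simp: d_def)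
  have G_add: "G (x + y) = G x + G y"
    if "x \<in> tangent S" "y \<in> tangent S" "norm x < d" "norm y < d" for x y
  proof -
    have xy: "norm (x + y) < 2 * d" using norm_triangle_ineq[of x y] that by linarith
    have "G (x + y) - (G x + G y) = F (x + y) - (F x + F y) + F 0" by (simp add: G_def)
    also have "\<dots> \<in> lattice T"
      by (intro lattice_closed(2)[OF T] add_lat F0 d2(2)) (use that xy d in auto)
    finally have lat: "G (x + y) - (G x + G y) \<in> lattice T" .
    have "norm (G (x + y)) < e / 3" "norm (G x) < e / 3" "norm (G y) < e / 3"
      by (intro d1(2); use that xy d tangent_closed(2)[OF S] in auto)+
    then have "norm (G (x + y) - (G x + G y)) < e"
      using norm_triangle_ineq4[of "G (x + y)" "G x + G y"] norm_triangle_ineq[of "G x" "G y"]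
      by linarith
    then show ?thesis using e(2)[OF lat] by simp
  qed
  have G_mult: "G (of_nat k *\<^sub>R x) = of_nat k *\<^sub>R G x"
    if "x \<in> tangent S" "real k * norm x < d" "norm x < d" for x k
    using that(2)
  proof (induction k)
    case 0
    then show ?case by (simp add: G_def)
  next
    case (Suc k)
    have k: "real k * norm x < d"
      using Suc.prems by (smt (verit) mult_right_mono norm_ge_zero of_nat_Suc)
    have "G (of_nat k *\<^sub>R x + x) = G (of_nat k *\<^sub>R x) + G x"
      by (rule G_add) (use that k tangent_scaleR[OF S] in auto)
    then show ?case using Suc.IH k by (simp add: algebra_simps)
  qed
  have G_eq: "G x = D x" if x: "x \<in> tangent S" "norm x < d" for x
  proof (cases "x = 0")
    case True
    then show ?thesis by (simp add: G_def)
  next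
    case False
    have "((\<lambda>y. (G y - D y) /\<^sub>R norm y) \<longlongrightarrow> 0) (at 0 within tangent S)"
      using G_deriv by (simp add: has_derivative_within G_def D.zero divide_inverse_commute)
    moreover have "filterlim (\<lambda>k. (1 / real (Suc k)) *\<^sub>R x) (at 0 within tangent S) sequentially"
      unfolding filterlim_at
    proof (intro conjI always_eventually allI)
      show "(\<lambda>k. (1 / real (Suc k)) *\<^sub>R x) \<longlonglongrightarrow> 0"
        by (rule tendsto_eq_rhs, rule tendsto_scaleR[OF LIMSEQ_Suc[OF lim_1_over_n] tendsto_const]) simp
    qed (use False x tangent_scaleR[OF S] in auto)
    ultimately have "(\<lambda>k. (G ((1 / real (Suc k)) *\<^sub>R x) - D ((1 / real (Suc k)) *\<^sub>R x)) /\<^sub>R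
        norm ((1 / real (Suc k)) *\<^sub>R x)) \<longlonglongrightarrow> 0"
      by (rule filterlim_compose)
    moreover have "(G ((1 / real (Suc k)) *\<^sub>R x) - D ((1 / real (Suc k)) *\<^sub>R x)) /\<^sub>R
        norm ((1 / real (Suc k)) *\<^sub>R x) = (G x - D x) /\<^sub>R norm x" for k
    proof -
      define y where "y = (1 / real (Suc k)) *\<^sub>R x"
      have xy: "x = real (Suc k) *\<^sub>R y" by (simp add: y_def)
      have "norm y \<le> norm x" by (simp add: y_def divide_le_eq mult_le_cancel_left1)
      then have "G x = real (Suc k) *\<^sub>R G y"
        using G_mult[of y "Suc k"] x tangent_scaleR[OF S x(1)] xy
        by (metis (no_types, lifting) abs_of_nat le_less_trans norm_scaleR y_def)
      moreover have "D x = real (Suc k) *\<^sub>R D y" by (subst xy) (rule D.scaleR)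
      moreover have "norm x = real (Suc k) * norm y" by (subst xy) simp
      ultimately show ?thesis
        unfolding y_def[symmetric]
        by (simp add: scaleR_diff_right[symmetric] del: of_nat_Suc)
    qed
    ultimately have "(G x - D x) /\<^sub>R norm x = 0" by (simp add: LIMSEQ_const_iff)
    then show ?thesis using False by simp
  qed
  have small: "f (torus_proj S x) = torus_proj T (D x) \<and> D x \<in> tangent T"
    if x: "x \<in> tangent S" "norm x < d" for x
  proof -
    have "x \<in> W" using d2(2) x d by force
    then have *: "F x \<in> tangent T" "f (torus_proj S x) = torus_proj T (F x)" using F x by auto
    have Dx: "D x = F x - F 0" using G_eq[OF x] by (simp add: G_def)
    then have "torus_proj T (F x) = torus_proj T (D x)" using F0 by (simp add: torus_proj_eq_iff[OF T])
    then show ?thesis using * Dx F0 lattice_closed(5)[OF T] tangent_closed(4)[OF T] by simp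
  qed
  have all: "f (torus_proj S x) = torus_proj T (D x) \<and> D x \<in> tangent T"
    if x: "x \<in> tangent S" for x
  proof -
    obtain k where k: "norm x / d < real k" using reals_Archimedean2 by blast
    then have k0: "k > 0" using d(1) by (metis divide_nonneg_pos norm_ge_zero not_gr_zero of_nat_0 not_le)
    define y where "y = (1 / real k) *\<^sub>R x"
    have y: "y \<in> tangent S" using x tangent_scaleR[OF S] by (simp add: y_def)
    have "norm y < d" using k k0 d(1) by (simp add: y_def field_simps)
    then have base: "f (torus_proj S y) = torus_proj T (D y)" "D y \<in> tangent T" using small y by auto
    have "f (torus_proj S (real (Suc j) *\<^sub>R y)) = torus_proj T (D (real (Suc j) *\<^sub>R y))" for j
    proof (induction j)
      case 0
      then show ?case using base by simp
    next
      case (Suc j)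
      have "real (Suc (Suc j)) *\<^sub>R y = real (Suc j) *\<^sub>R y + y"
        by (metis add.commute of_nat_Suc scaleR_left_distrib scaleR_one)
      moreover have "f (torus_proj S (real (Suc j) *\<^sub>R y + y)) =
          torus_proj T (D (real (Suc j) *\<^sub>R y)) \<otimes>\<^bsub>points T\<^esub> torus_proj T (D y)"
        using f_hom[of "real (Suc j) *\<^sub>R y" y] Suc.IH base y tangent_scaleR[OF S y] by simp
      moreover have "\<dots> = torus_proj T (D (real (Suc j) *\<^sub>R y) + D y)"
        by (rule points_mult[OF T]) (use base tangent_scaleR[OF T] in \<open>auto simp: D.scaleR\<close>)
      ultimately show ?case by (simp only: D.add)
    qed
    from this[of "k - 1"] have "f (torus_proj S x) = torus_proj T (D x)"
      using k0 by (simp add: y_def)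
    moreover have "D x = real k *\<^sub>R D y" using k0 by (simp add: y_def D.scaleR)
    ultimately show ?thesis using base tangent_scaleR[OF T] by simp
  qed
  show ?thesis
    by (rule exI[of _ "\<lambda>v. if v \<in> tangent S then D v else 0"])
       (use all Dc tangent_closed[OF S] in \<open>auto simp: is_analytic_rep_def D.add\<close>)
qed

lemma is_analytic_rep_analytic_rep:
  assumes "complex_torus S" "complex_torus T" "f \<in> torus_hom S T"
  shows "is_analytic_rep S T f (analytic_rep S T f)"
  unfolding analytic_rep_def
  using is_analytic_rep_exists[OF assms] is_analytic_rep_unique[OF assms(1,2)]
  by (metis theI)

lemma is_analytic_rep_lattice:
  assumes S: "complex_torus S" and T: "complex_torus T"
    and U: "is_analytic_rep S T f U" and l: "l \<in> lattice S"
  shows "U l \<in> lattice T"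
proof -
  have lin: "U (c *s v) = c *s U v" "f (torus_proj S v) = torus_proj T (U v)"
    if "v \<in> tangent S" for c v
    using U that by (simp_all add: is_analytic_rep_def)
  have U0: "U 0 = 0" using lin(1)[of 0 0] tangent_closed(1)[OF S] by simp
  have "torus_proj S l = torus_proj S 0" using l by (simp add: torus_proj_eq_iff[OF S])
  then have "torus_proj T (U l) = torus_proj T (U 0)"
    using lin(2)[of l] lin(2)[of 0] lattice_closed(5)[OF S l] tangent_closed(1)[OF S] by simp
  then show ?thesis by (simp add: torus_proj_eq_iff[OF T] U0)
qed

lemma dual_lattice_closed:
  shows "0 \<in> dual_lattice S"
    and "x \<in> dual_lattice S \<Longrightarrow> y \<in> dual_lattice S \<Longrightarrow> x + y \<in> dual_lattice S"
    and "x \<in> dual_lattice S \<Longrightarrow> y \<in> dual_lattice S \<Longrightarrow> x - y \<in> dual_lattice S"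
  by (auto simp: dual_lattice_def dual_tangent_def algebra_simps)

lemma dual_proj_add_lattice:
  assumes "m \<in> dual_lattice S"
  shows "dual_proj S (m + l) = dual_proj S l"
  unfolding dual_proj_eq
proof (intro subset_antisym subsetI; elim imageE)
  fix x k assume "x = k + (m + l)" "k \<in> dual_lattice S"
  then show "x \<in> (\<lambda>k. k + l) ` dual_lattice S"
    using dual_lattice_closed(2)[OF _ assms] by (intro image_eqI[of _ _ "k + m"]) (auto simp: add.assoc)
next
  fix x k assume "x = k + l" "k \<in> dual_lattice S"
  then show "x \<in> (\<lambda>k. k + (m + l)) ` dual_lattice S"
    using dual_lattice_closed(3)[OF _ assms]
    by (intro image_eqI[of _ _ "k - m"]) (auto simp: algebra_simps)
qed

lemma phi_torus_proj:
  assumes S: "complex_torus S" and H: "polarization S H" and v: "v \<in> tangent S"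
  shows "phi S H (torus_proj S v) = dual_proj S (H v)"
proof -
  note H' = H[unfolded polarization_def]
  note H1 = H'[THEN conjunct1]
  note H2 = H'[THEN conjunct2, THEN conjunct1]
  note H3 = H'[THEN conjunct2, THEN conjunct2, THEN conjunct1]
  note H4 = H'[THEN conjunct2, THEN conjunct2, THEN conjunct2, THEN conjunct1]
  note H6 = H'[THEN conjunct2, THEN conjunct2, THEN conjunct2, THEN conjunct2, THEN conjunct2]
  have H0: "H x y = 0" if "x \<notin> tangent S \<or> y \<notin> tangent S" for x y
    by (rule H1[rule_format]) (use that in auto)
  have H_add: "H (x + x') y = H x y + H x' y" if "x \<in> tangent S" "x' \<in> tangent S" "y \<in> tangent S" for x x' y
    by (rule H2[rule_format]) (use that in auto)
  have H_scale: "H (c *s x) y = c * H x y" if "x \<in> tangent S" "y \<in> tangent S" for c x y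
    by (rule H3[rule_format]) (use that in auto)
  have H_sym: "H x y = cnj (H y x)" if "x \<in> tangent S" "y \<in> tangent S" for x y
    by (rule H4[rule_format]) (use that in auto)
  have H_int: "Im (H l m) \<in> \<int>" if "l \<in> lattice S" "m \<in> lattice S" for l m
    by (rule H6[rule_format]) (use that in auto)
  have "H l \<in> dual_lattice S" if l: "l \<in> lattice S" for l
  proof -
    have lt: "l \<in> tangent S" by (rule lattice_closed(5)[OF S l])
    have "H l (x + y) = H l x + H l y" if "x \<in> tangent S" "y \<in> tangent S" for x y
      using H_sym[OF lt] H_add[OF that lt] that tangent_closed(2)[OF S that] by simp
    moreover have "H l (c *s x) = cnj c * H l x" if "x \<in> tangent S" for c x
      using H_sym[OF lt] H_scale[OF that lt] that tangent_closed(5)[OF S that] by simp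
    ultimately show ?thesis
      using H0 H_int[OF l] by (simp add: dual_lattice_def dual_tangent_def)
  qed
  moreover have "H (l + v) = H l + H v" if "l \<in> lattice S" for l
  proof
    fix w
    show "H (l + v) w = (H l + H v) w"
      using H0 H_add[OF lattice_closed(5)[OF S that] v, of w] by (cases "w \<in> tangent S") auto
  qed
  ultimately have eq: "dual_proj S (H x) = dual_proj S (H v)" if "x \<in> torus_proj S v" for x
    using that by (auto simp: torus_proj_eq dual_proj_add_lattice)
  have "torus_proj S v \<noteq> {}"
    using lattice_closed(1)[OF S] unfolding torus_proj_eq by blast
  then show ?thesis
    unfolding phi_def by (rule the_elem_image_unique) (rule eq)
qed

lemma dual_hom_dual_proj:
  assumes S: "complex_torus S" and T: "complex_torus T" and f: "f \<in> torus_hom S T"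
  shows "dual_hom S T f (dual_proj T l) = dual_proj S (l \<circ> analytic_rep S T f)"
proof -
  define U where "U = analytic_rep S T f"
  have U: "is_analytic_rep S T f U"
    unfolding U_def by (rule is_analytic_rep_analytic_rep[OF S T f])
  have "m \<circ> U \<in> dual_lattice S" if m: "m \<in> dual_lattice T" for m
  proof -
    have "m (0 *s 0) = cnj 0 * m 0"
      using m tangent_closed(1)[OF T] unfolding dual_lattice_def dual_tangent_def by blast
    then have "m 0 = 0" by simp
    then show ?thesis
      using m U is_analytic_rep_lattice[OF S T U]
      by (simp add: dual_lattice_def dual_tangent_def is_analytic_rep_def)
  qed
  moreover have "(m + l) \<circ> U = (m \<circ> U) + (l \<circ> U)" for m by auto
  ultimately have eq: "dual_proj S (x \<circ> U) = dual_proj S (l \<circ> U)" if "x \<in> dual_proj T l" for x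
    using that by (auto simp: dual_proj_eq[of T] dual_proj_add_lattice)
  have "dual_proj T l \<noteq> {}"
    using dual_lattice_closed(1)[of T] unfolding dual_proj_eq by blast
  then show ?thesis
    unfolding dual_hom_def U_def[symmetric] by (rule the_elem_image_unique) (rule eq)
qed

lemma is_image_torus_exists:
  assumes S: "complex_torus S" and f: "f \<in> torus_End S"
  shows "\<exists>A. is_image_torus A S f"
proof -
  define U where "U = analytic_rep S S f"
  have U: "is_analytic_rep S S f U"
    unfolding U_def by (rule is_analytic_rep_analytic_rep[OF S S f])
  have U_add: "U (v + w) = U v + U w" if "v \<in> tangent S" "w \<in> tangent S" for v w
    using U that by (simp add: is_analytic_rep_def)
  have U_scale: "U (c *s v) = c *s U v" if "v \<in> tangent S" for c v
    using U that by (simp add: is_analytic_rep_def)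
  have U_in: "U v \<in> tangent S" "f (torus_proj S v) = torus_proj S (U v)" if "v \<in> tangent S" for v
    using U that by (auto simp: is_analytic_rep_def)
  have U_0: "U 0 = 0" using U_scale[of 0 0] tangent_closed(1)[OF S] by simp
  define A where "A = \<lparr>tangent = U ` tangent S, lattice = lattice S \<inter> U ` tangent S\<rparr>"
  have sub: "vec.subspace (U ` tangent S)"
    unfolding vec.subspace_def
    using U_0 tangent_closed[OF S] by (auto simp flip: U_add U_scale intro: image_eqI[of 0 U 0])
  have U_lat: "U l \<in> lattice S" if l: "l \<in> lattice S" for l
    using is_analytic_rep_lattice[OF S S U l] .
  have real_sub: "subspace (U ` tangent S)"
    using sub unfolding vec.subspace_def subspace_def by (auto simp: scaleR_eq_vector_smult)
  have "v \<in> tangent S \<and> U v \<in> span (lattice A)" if "v \<in> span (lattice S)" for v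
    using that
  proof (induction rule: span_induct_alt)
    case base
    then show ?case using U_0 tangent_closed(1)[OF S] span_0 by simp
  next
    case (step c x y)
    have x: "x \<in> tangent S" using step lattice_closed(5)[OF S] by auto
    have "U x \<in> span (lattice A)" using step U_lat x by (auto simp: A_def intro: span_base)
    moreover have "U (c *\<^sub>R x + y) = c *\<^sub>R U x + U y"
      using step x tangent_scaleR[OF S x] U_add U_scale by (simp add: scaleR_eq_vector_smult)
    ultimately show ?case
      using step x tangent_scaleR[OF S x] tangent_closed(2)[OF S] by (simp add: span_add span_scale)
  qed
  moreover have "span (lattice S) = tangent S" using S by (simp add: complex_torus_def)
  ultimately have "U ` tangent S \<subseteq> span (lattice A)" by auto
  moreover have "span (lattice A) \<subseteq> U ` tangent S"
    by (rule span_minimal[OF _ real_sub]) (auto simp: A_def)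
  ultimately have span: "span (lattice A) = tangent A" by (auto simp: A_def)
  have cg: "comm_group (vector_group (tangent A))"
    by (rule comm_group_vector_group)
       (use sub in \<open>auto simp: A_def intro: vec.subspace_0 vec.subspace_add vec.subspace_neg\<close>)
  then interpret cg: comm_group "vector_group (tangent A)" .
  have inv: "inv\<^bsub>vector_group (tangent A)\<^esub> x = - x" if "x \<in> tangent A" for x
    by (rule cg.inv_equality) (use that sub in \<open>auto simp: A_def intro: vec.subspace_neg\<close>)
  have "subgroup (lattice A) (vector_group (tangent A))"
  proof (rule cg.subgroupI)
    show "lattice A \<noteq> {}"
      using lattice_closed(1)[OF S] vec.subspace_0[OF sub] by (auto simp: A_def)
    show "inv\<^bsub>vector_group (tangent A)\<^esub> x \<in> lattice A" if "x \<in> lattice A" for x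
      using that inv[of x] lattice_closed(3)[OF S] vec.subspace_neg[OF sub] by (auto simp: A_def)
    show "x \<otimes>\<^bsub>vector_group (tangent A)\<^esub> y \<in> lattice A" if "x \<in> lattice A" "y \<in> lattice A" for x y
      using that lattice_closed(2)[OF S] vec.subspace_add[OF sub] by (auto simp: A_def)
  qed (auto simp: A_def)
  moreover have "discrete (lattice A)"
    using S by (auto simp: complex_torus_def A_def elim: discrete_subset)
  ultimately have "complex_torus A" using sub span by (simp add: complex_torus_def A_def)
  then have "subtorus A S" using U_in by (auto simp: subtorus_def A_def)
  moreover have incl: "torus_incl S (torus_proj A a) = torus_proj S a" for a
  proof -
    have 0: "0 \<in> lattice A"
      using lattice_closed(1)[OF S] vec.subspace_0[OF sub] by (simp add: A_def)
    have 1: "l + m \<in> lattice S" if "l \<in> lattice S" "m \<in> lattice A" for l m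
      using that lattice_closed(2)[OF S] by (simp add: A_def)
    show ?thesis
    proof (intro subset_antisym subsetI)
      fix x assume "x \<in> torus_incl S (torus_proj A a)"
      then obtain l m where "l \<in> lattice S" "m \<in> lattice A" "x = l + (m + a)"
        by (auto simp: torus_incl_def set_mult_def torus_proj_eq)
      then show "x \<in> torus_proj S a"
        unfolding torus_proj_eq using 1 by (intro image_eqI[of _ _ "l + m"]) (auto simp: add.assoc)
    next
      fix x assume "x \<in> torus_proj S a"
      then show "x \<in> torus_incl S (torus_proj A a)"
        using 0 by (force simp: torus_incl_def set_mult_def torus_proj_eq)
    qed
  qed
  have "torus_incl S ` carrier (points A) = f ` carrier (points S)"
    using U_in(2) by (simp add: carrier_points image_image incl) (simp add: A_def image_image)
  ultimately show ?thesis unfolding is_image_torus_def by blast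
qed

end

theory Submission
  imports Defs
begin

text \<open>
  Write \<open>S = V / \<Lambda>\<close>, let \<open>E\<close> be the imaginary part of the Hermitian form of \<open>L\<close>, and let \<open>U\<close> be the
  complex linear map of \<open>V\<close> that induces \<open>u\<close>. The hypotheses on \<open>u\<close> hold for the lifts only modulo
  \<open>\<Lambda>\<close> or \<open>\<int>\<close>, but both sides are linear, and a discrete group contains no line. So they are
  identities: \<open>E (U v) w = E v (U w)\<close> (\<open>adjoint_if_intertwines_phi\<close>) and \<open>U (U v) = q U v\<close>
  (\<open>analytic_rep_quadratic\<close>). The image \<open>A\<close> has tangent space \<open>U V\<close> and lattice \<open>\<Lambda> \<inter> U V\<close>.
  The endomorphism \<open>q - u\<close> is induced by \<open>q - U\<close>, which satisfies the same two identities, so (a) and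
  (b) are both instances of \<open>pol_kernel_of_root_on_image\<close>.

  The kernel of a polarization is the image in the torus of the lattice of all vectors that pair
  integrally with the period lattice. It is therefore enough to show that \<open>U\<close> maps this lattice for
  \<open>L\<close> onto the one for \<open>M\<close>. On \<open>U V\<close> the map \<open>U\<close> is multiplication by \<open>q\<close>, and \<open>E\<close> is \<open>q\<close> times the
  form \<open>E\<^sub>M\<close> of \<open>M\<close>. Hence \<open>q E\<^sub>M (U v) a = E (U v) a = E v (U a) = q E v a\<close>, that is
  \<open>E\<^sub>M (U v) a = E v a\<close> for all \<open>a\<close> in \<open>U V\<close>. If \<open>v\<close> is integral on \<open>\<Lambda>\<close>, this shows that \<open>U v\<close> is
  integral on \<open>\<Lambda> \<inter> U V\<close>.

  Conversely, if \<open>U b\<close> is integral on \<open>\<Lambda> \<inter> U V\<close>, then so is \<open>E b\<close>. Because \<open>\<Lambda> \<inter> U V\<close> is the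
  intersection of \<open>\<Lambda>\<close> with a subspace, it is a direct summand, and the restriction of \<open>E b\<close> to it
  extends to an integral functional on \<open>\<Lambda>\<close> (\<open>extend_integral_functional\<close>). By nondegeneracy the
  extension is \<open>E v\<close> for some \<open>v\<close> in \<open>V\<close> (\<open>alternating_form_represents\<close>). As \<open>E v\<close> and \<open>E b\<close> agree on
  \<open>U V\<close>, adjointness makes \<open>U (v - b)\<close> orthogonal to all of \<open>V\<close>, so \<open>U v = U b\<close>.
\<close>

section \<open>Discrete subgroups of Euclidean spaces\<close>

locale discrete_subgroup =
  fixes \<Lambda> :: "'a::euclidean_space set"
  assumes zero: "0 \<in> \<Lambda>"
    and diff: "x \<in> \<Lambda> \<Longrightarrow> y \<in> \<Lambda> \<Longrightarrow> x - y \<in> \<Lambda>"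
    and uniform_discrete: "uniform_discrete \<Lambda>"
begin

lemma neg: "x \<in> \<Lambda> \<Longrightarrow> - x \<in> \<Lambda>"
  using diff[OF zero] by simp

lemma add: "x \<in> \<Lambda> \<Longrightarrow> y \<in> \<Lambda> \<Longrightarrow> x + y \<in> \<Lambda>"
  using diff[OF _ neg] by simp

lemma int_multiple: "x \<in> \<Lambda> \<Longrightarrow> of_int k *\<^sub>R x \<in> \<Lambda>"
proof (induction k rule: int_induct[of _ 0])
  case base
  then show ?case by (simp add: zero)
next
  case (step1 i)
  then show ?case using add by (simp add: scaleR_left_distrib)
next
  case (step2 i)
  then show ?case using diff by (simp add: scaleR_left_diff_distrib)
qed

lemma finite_bounded: "finite {x \<in> \<Lambda>. norm x \<le> r}"
proof -
  have "bounded {x \<in> \<Lambda>. norm x \<le> r}" by (auto simp: bounded_iff)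
  moreover have "uniform_discrete {x \<in> \<Lambda>. norm x \<le> r}"
    using uniform_discrete by (rule uniform_discrete_subset) auto
  ultimately show ?thesis using uniform_discrete_finite_iff by blast
qed

lemma countable: "countable \<Lambda>"
proof -
  have "\<Lambda> = (\<Union>n::nat. {x \<in> \<Lambda>. norm x \<le> real n})"
    using real_arch_simple by auto
  moreover have "countable (\<Union>n::nat. {x \<in> \<Lambda>. norm x \<le> real n})"
    by (intro countable_UN) (auto intro: countable_finite finite_bounded)
  ultimately show ?thesis by simp
qed

text \<open>
  The uncountably many points of a line \<open>\<real> v\<close> in \<open>V\<close> lie in the countably many translates of \<open>W\<close> by
  elements of \<open>\<Lambda>\<close>, so two of them differ by an element of \<open>W\<close>, which then contains \<open>v\<close>.
  This recovers the tangent space of a subtorus from its set of points.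
\<close>

lemma subspace_subset_if_subset_translates:
  assumes V: "subspace V" and W: "subspace W"
    and cover: "\<And>v. v \<in> V \<Longrightarrow> \<exists>w\<in>W. v - w \<in> \<Lambda>"
  shows "V \<subseteq> W"
proof
  fix v assume v: "v \<in> V"
  have "\<exists>w\<in>W. r *\<^sub>R v - w \<in> \<Lambda>" for r
    by (rule cover) (use V v in \<open>simp add: subspace_scale\<close>)
  then obtain w where w: "\<And>r. w r \<in> W" "\<And>r. r *\<^sub>R v - w r \<in> \<Lambda>" by metis
  define f where "f r = r *\<^sub>R v - w r" for r
  have "\<not> inj f"
  proof
    assume "inj f"
    moreover have "countable (range f)"
      by (rule countable_subset[OF _ countable]) (auto simp: f_def w)
    ultimately have "countable (UNIV :: real set)" using countable_image_inj_on by blast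
    then show False using uncountable_UNIV_real by blast
  qed
  then obtain r s where rs: "r \<noteq> s" "f r = f s" unfolding inj_def by blast
  have "(r - s) *\<^sub>R v = w r - w s" using rs(2) by (simp add: f_def algebra_simps)
  then have "(r - s) *\<^sub>R v \<in> W" using W w by (simp add: subspace_diff)
  then have "(1 / (r - s)) *\<^sub>R (r - s) *\<^sub>R v \<in> W" using W subspace_scale by blast
  then show "v \<in> W" using rs(1) by simp
qed

text \<open>
  Rounding down the coefficients with respect to \<open>C\<close> moves \<open>w\<close> into the bounded parallelepiped spanned
  by \<open>C\<close>. Minimal elements of \<open>\<Lambda>\<close> may thus be sought in a bounded, hence finite, part of \<open>\<Lambda>\<close>.
\<close>

lemma reduce_modulo_span:
  assumes C: "finite C" "C \<subseteq> \<Lambda>" and w: "w \<in> span C"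
  obtains m where "m \<in> \<Lambda>" "m \<in> span C" "norm (w - m) \<le> (\<Sum>b\<in>C. norm b)"
proof -
  obtain r where r: "w = (\<Sum>b\<in>C. r b *\<^sub>R b)" using w C by (auto simp: span_finite)
  define m where "m = (\<Sum>b\<in>C. of_int \<lfloor>r b\<rfloor> *\<^sub>R b)"
  have "(\<Sum>b\<in>D. of_int \<lfloor>r b\<rfloor> *\<^sub>R b) \<in> \<Lambda>" if "D \<subseteq> C" for D
    using finite_subset[OF that C(1)] that
    by (induction D rule: finite_induct) (use C(2) in \<open>auto simp: zero intro!: add int_multiple\<close>)
  then have 1: "m \<in> \<Lambda>" by (simp add: m_def)
  have 2: "m \<in> span C" unfolding m_def by (intro span_sum span_scale span_base)
  have "w - m = (\<Sum>b\<in>C. frac (r b) *\<^sub>R b)"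
    by (simp add: r m_def frac_def scaleR_left_diff_distrib sum_subtractf)
  also have "norm \<dots> \<le> (\<Sum>b\<in>C. norm b)"
    by (rule sum_norm_le) (simp add: frac_ge_0 mult_left_le_one_le less_imp_le[OF frac_lt_1])
  finally show ?thesis using that 1 2 by blast
qed

text \<open>
  If \<open>l\<close> is not in \<open>span C\<close>, let \<open>h\<close> be the \<open>l\<close>-coordinate modulo \<open>span C\<close>. Its values on \<open>\<Lambda> \<inter> span (insert l C)\<close> are the integer
  multiples of the least positive one, attained at some \<open>m\<close>, so this group is the direct sum of
  \<open>\<Lambda> \<inter> span C\<close> and \<open>\<int> m\<close>, and one may prescribe \<open>g' m = 0\<close>.
\<close>

lemma extend_integral_functional_step:
  fixes g :: "'a \<Rightarrow> real"
  assumes C: "finite C" "C \<subseteq> \<Lambda>" and l: "l \<in> \<Lambda>"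
    and g: "linear g" and int: "\<And>x. x \<in> \<Lambda> \<Longrightarrow> x \<in> span C \<Longrightarrow> g x \<in> \<int>"
  shows "\<exists>g'. linear g' \<and> (\<forall>x \<in> span C. g' x = g x) \<and> (\<forall>x \<in> \<Lambda> \<inter> span (insert l C). g' x \<in> \<int>)"
proof (cases "l \<in> span C")
  case True
  then have "span (insert l C) = span C" by (rule span_redundant)
  then show ?thesis using g int by (intro exI[of _ g]) auto
next
  case False
  obtain B where B: "B \<subseteq> C" "independent B" "C \<subseteq> span B"
    using maximal_independent_subset .
  have span_B: "span B = span C"
    using B(1,3) by (metis span_mono span_span subset_antisym)
  have "independent (insert l B)" using B(2) False by (simp add: independent_insert span_B)
  then obtain h :: "'a \<Rightarrow> real" where h: "linear h" "\<forall>x\<in>insert l B. h x = (if x = l then 1 else 0)"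
    using linear_independent_extend[of "insert l B" "\<lambda>x. if x = l then 1 else 0"] by blast
  have h_l: "h l = 1" using h(2) by simp
  have h_span: "h x = 0" if "x \<in> span C" for x
  proof -
    have "h b = 0" if "b \<in> B" for b
      using h(2) that False span_base[of b B] by (auto simp: span_B)
    then show ?thesis using linear_eq_0_on_span[OF h(1), of B x] that by (simp add: span_B)
  qed
  have h_coeff: "x - h x *\<^sub>R l \<in> span C" if x: "x \<in> span (insert l C)" for x
  proof -
    obtain k where k: "x - k *\<^sub>R l \<in> span C" using x by (auto simp: span_breakdown_eq)
    have "h x = k"
      using h_span[OF k] h_l by (simp add: linear_diff[OF h(1)] linear_scale[OF h(1)])
    then show ?thesis using k by simp
  qed
  \<comment> \<open>The bound on the norm makes the set finite and is large enough to contain, up to a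
    translation by \<open>\<Lambda> \<inter> span C\<close>, every lattice vector whose coordinate lies in \<open>(0, 1]\<close>.\<close>
  define X where
    "X = {x \<in> \<Lambda> \<inter> span (insert l C). 0 < h x \<and> h x \<le> 1 \<and> norm x \<le> (\<Sum>b\<in>C. norm b) + norm l}"
  have "finite X"
    by (rule finite_subset[OF _ finite_bounded[of "(\<Sum>b\<in>C. norm b) + norm l"]]) (auto simp: X_def)
  moreover have "l \<in> X" using l h_l by (auto simp: X_def span_base sum_nonneg)
  ultimately have "\<exists>m. is_arg_min h (\<lambda>x. x \<in> X) m"
    using ex_is_arg_min_if_finite[of X h] by auto
  then obtain m where m: "m \<in> X" and m_min: "\<And>x. x \<in> X \<Longrightarrow> h m \<le> h x"
    by (auto simp: is_arg_min_linorder)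
  have m': "m \<in> \<Lambda>" "m \<in> span (insert l C)" "0 < h m" "h m \<le> 1" using m by (auto simp: X_def)
  have split: "\<exists>k. x - of_int k *\<^sub>R m \<in> \<Lambda> \<inter> span C" if x: "x \<in> \<Lambda>" "x \<in> span (insert l C)" for x
  proof -
    define k where "k = \<lfloor>h x / h m\<rfloor>"
    define y where "y = x - of_int k *\<^sub>R m"
    have y: "y \<in> \<Lambda>" "y \<in> span (insert l C)"
      using x m' by (auto simp: y_def intro: diff int_multiple span_diff span_scale)
    have hy_eq: "h y = h x - of_int k * h m" by (simp add: y_def linear_diff[OF h(1)] linear_scale[OF h(1)])
    have "of_int k \<le> h x / h m" "h x / h m < of_int k + 1" unfolding k_def by linarith+
    then have hy: "0 \<le> h y" "h y < h m" using m'(3) unfolding hy_eq by (simp_all add: field_simps)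
    \<comment> \<open>A positive remainder would give, after reduction modulo \<open>\<Lambda> \<inter> span C\<close>, an element
      of \<open>X\<close> that contradicts the choice of \<open>m\<close>.\<close>
    have "h y = 0"
    proof (rule ccontr)
      assume "h y \<noteq> 0"
      obtain p where p: "p \<in> \<Lambda>" "p \<in> span C" "norm (y - h y *\<^sub>R l - p) \<le> (\<Sum>b\<in>C. norm b)"
        using reduce_modulo_span[OF C h_coeff[OF y(2)]] by blast
      have "h y * norm l \<le> 1 * norm l" by (rule mult_right_mono) (use hy m'(4) in auto)
      then have "norm (h y *\<^sub>R l) \<le> norm l" using hy(1) by simp
      moreover have "norm (y - p) \<le> norm (y - h y *\<^sub>R l - p) + norm (h y *\<^sub>R l)"
        using norm_triangle_ineq[of "y - h y *\<^sub>R l - p" "h y *\<^sub>R l"] by (simp add: algebra_simps)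
      moreover have "h (y - p) = h y" using h_span[OF p(2)] by (simp add: linear_diff[OF h(1)])
      moreover have "p \<in> span (insert l C)" using p(2) span_mono[of C "insert l C"] by auto
      ultimately have "y - p \<in> X"
        using p y hy \<open>h y \<noteq> 0\<close> m'(4) by (auto simp: X_def intro: diff span_diff)
      then show False using m_min \<open>h (y - p) = h y\<close> hy(2) by fastforce
    qed
    then have "y \<in> span C" using h_coeff[OF y(2)] by simp
    then show ?thesis using y(1) unfolding y_def by blast
  qed
  \<comment> \<open>Subtract the multiple of \<open>h\<close> that makes the result vanish at \<open>m\<close>; nothing changes on \<open>span C\<close>.\<close>
  define g' where "g' x = g x - (g m / h m) * h x" for x
  have g': "linear g'"
    unfolding g'_def by (intro linearI)
      (simp_all add: linear_add[OF g] linear_add[OF h(1)] linear_scale[OF g] linear_scale[OF h(1)]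
        algebra_simps add_divide_distrib)
  have g'_span: "g' x = g x" if "x \<in> span C" for x using h_span[OF that] by (simp add: g'_def)
  have "g' x \<in> \<int>" if x: "x \<in> \<Lambda> \<inter> span (insert l C)" for x
  proof -
    obtain k where k: "x - of_int k *\<^sub>R m \<in> \<Lambda> \<inter> span C" using split x by blast
    have "g' m = 0" using m'(3) by (simp add: g'_def)
    then have "g' x = g' (x - of_int k *\<^sub>R m)" by (simp add: linear_diff[OF g'] linear_scale[OF g'])
    then show ?thesis using k g'_span int by simp
  qed
  then show ?thesis using g' g'_span by blast
qed

text \<open>
  When \<open>F\<close> spans \<open>\<Lambda>\<close>, integral functionals thus extend from \<open>\<Lambda> \<inter> span C\<close> to \<open>\<Lambda>\<close>, which expresses that
  \<open>\<Lambda> \<inter> span C\<close> is a direct summand.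
\<close>

lemma extend_integral_functional:
  fixes g :: "'a \<Rightarrow> real"
  assumes C: "finite C" "C \<subseteq> \<Lambda>" and F: "finite F" "F \<subseteq> \<Lambda>"
    and g: "linear g" and int: "\<And>x. x \<in> \<Lambda> \<Longrightarrow> x \<in> span C \<Longrightarrow> g x \<in> \<int>"
  shows "\<exists>g'. linear g' \<and> (\<forall>x \<in> span C. g' x = g x) \<and> (\<forall>x \<in> \<Lambda> \<inter> span (F \<union> C). g' x \<in> \<int>)"
  using F
proof (induction F rule: finite_induct)
  case empty
  then show ?case using g int by (intro exI[of _ g]) auto
next
  case (insert l F)
  then obtain g1 where g1: "linear g1" "\<forall>x \<in> span C. g1 x = g x" "\<forall>x \<in> \<Lambda> \<inter> span (F \<union> C). g1 x \<in> \<int>"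
    by auto
  obtain g2 where g2: "linear g2" "\<forall>x \<in> span (F \<union> C). g2 x = g1 x"
      "\<forall>x \<in> \<Lambda> \<inter> span (insert l (F \<union> C)). g2 x \<in> \<int>"
    using extend_integral_functional_step[of "F \<union> C" l g1] insert g1 C by auto
  have "span C \<subseteq> span (F \<union> C)" by (intro span_mono) auto
  then show ?case using g1 g2 by (intro exI[of _ g2]) auto
qed

end


section \<open>The alternating form of a polarization\<close>

lemma discrete_subgroup_lattice:
  assumes S: "complex_torus S"
  shows "discrete_subgroup (lattice S)"
proof
  show "0 \<in> lattice S" by (rule lattice_closed(1)[OF S])
  show diff: "x - y \<in> lattice S" if "x \<in> lattice S" "y \<in> lattice S" for x y
    by (rule lattice_closed(4)[OF S that])
  obtain e where e: "e > 0" "\<And>x. x \<in> lattice S \<Longrightarrow> norm x < e \<Longrightarrow> x = 0"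
    using lattice_separated[OF S] by blast
  show "uniform_discrete (lattice S)"
  proof (rule uniformI1[OF e(1)])
    fix x y assume "x \<in> lattice S" "y \<in> lattice S" "dist x y < e"
    then show "x = y" using e(2)[OF diff[of x y]] by (simp add: dist_norm)
  qed
qed

lemma subspace_tangent: "complex_torus S \<Longrightarrow> subspace (tangent S)"
  unfolding subspace_def by (auto intro: tangent_closed tangent_scaleR)

lemma span_lattice: "complex_torus S \<Longrightarrow> span (lattice S) = tangent S"
  by (simp add: complex_torus_def)

lemma tangent_induct [consumes 2, case_names zero step]:
  assumes S: "complex_torus S" and v: "v \<in> tangent S"
    and zero: "P 0"
    and step: "\<And>c l w. l \<in> lattice S \<Longrightarrow> w \<in> tangent S \<Longrightarrow> P w \<Longrightarrow> P (c *\<^sub>R l + w)"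
  shows "P v"
proof -
  have "v \<in> tangent S \<and> P v" if "v \<in> span (lattice S)" for v
    using that
  proof (induction rule: span_induct_alt)
    case base
    then show ?case using zero tangent_closed(1)[OF S] by simp
  next
    case (step c l w)
    then show ?case
      using assms(4) tangent_closed(2)[OF S] tangent_scaleR[OF S] lattice_closed(5)[OF S] by blast
  qed
  then show ?thesis using v by (simp add: span_lattice[OF S])
qed

lemma polarization_linear:
  assumes S: "complex_torus S" and H: "polarization S H"
  shows "v \<notin> tangent S \<or> w \<notin> tangent S \<Longrightarrow> H v w = 0"
    and "v \<in> tangent S \<Longrightarrow> v' \<in> tangent S \<Longrightarrow> w \<in> tangent S \<Longrightarrow> H (v + v') w = H v w + H v' w"
    and "v \<in> tangent S \<Longrightarrow> w \<in> tangent S \<Longrightarrow> H (c *s v) w = c * H v w"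
    and "v \<in> tangent S \<Longrightarrow> w \<in> tangent S \<Longrightarrow> H w v = cnj (H v w)"
    and "v \<in> tangent S \<Longrightarrow> v \<noteq> 0 \<Longrightarrow> Re (H v v) > 0"
    and "v \<in> tangent S \<Longrightarrow> w \<in> tangent S \<Longrightarrow> w' \<in> tangent S \<Longrightarrow> H v (w + w') = H v w + H v w'"
    and "v \<in> tangent S \<Longrightarrow> w \<in> tangent S \<Longrightarrow> H v (c *s w) = cnj c * H v w"
proof -
  show 0: "H v w = 0" if "v \<notin> tangent S \<or> w \<notin> tangent S" for v w
    using H that unfolding polarization_def by metis
  show add: "H (v + v') w = H v w + H v' w" if "v \<in> tangent S" "v' \<in> tangent S" "w \<in> tangent S" for v v' w
    using H that unfolding polarization_def by metis
  show scale: "H (c *s v) w = c * H v w" if "v \<in> tangent S" "w \<in> tangent S" for c v w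
    using H that unfolding polarization_def by metis
  show herm: "H w v = cnj (H v w)" if "v \<in> tangent S" "w \<in> tangent S" for v w
    using H that unfolding polarization_def by metis
  show "Re (H v v) > 0" if "v \<in> tangent S" "v \<noteq> 0" for v
    using H that unfolding polarization_def by metis
  show "H v (w + w') = H v w + H v w'" if "v \<in> tangent S" "w \<in> tangent S" "w' \<in> tangent S" for v w w'
    using add[of w w' v] herm that tangent_closed(2)[OF S] by (metis complex_cnj_add)
  show "H v (c *s w) = cnj c * H v w" if "v \<in> tangent S" "w \<in> tangent S" for c v w
    using scale[of w v c] herm that tangent_closed(5)[OF S] by (metis complex_cnj_mult)
qed

text \<open>
  The first Chern class as a real alternating form. All integrality conditions, on the class itself
  and in the dual lattice, concern this imaginary part.
\<close>

definition alternating_form ::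
  "(complex ^ 'n \<Rightarrow> complex ^ 'n \<Rightarrow> complex) \<Rightarrow> complex ^ 'n \<Rightarrow> complex ^ 'n::finite \<Rightarrow> real" where
  "alternating_form H v w = Im (H v w)"

lemma alternating_form_linear:
  assumes S: "complex_torus S" and H: "polarization S H"
    and v: "v \<in> tangent S" and w: "w \<in> tangent S"
  shows "v' \<in> tangent S \<Longrightarrow> alternating_form H (v + v') w = alternating_form H v w + alternating_form H v' w"
    and "v' \<in> tangent S \<Longrightarrow> alternating_form H (v - v') w = alternating_form H v w - alternating_form H v' w"
    and "alternating_form H (r *\<^sub>R v) w = r * alternating_form H v w"
    and "w' \<in> tangent S \<Longrightarrow> alternating_form H v (w + w') = alternating_form H v w + alternating_form H v w'"
    and "w' \<in> tangent S \<Longrightarrow> alternating_form H v (w - w') = alternating_form H v w - alternating_form H v w'"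
    and "alternating_form H v (r *\<^sub>R w) = r * alternating_form H v w"
proof -
  note lin = polarization_linear[OF S H]
  have add1: "alternating_form H (v + v') w = alternating_form H v w + alternating_form H v' w"
    if "v \<in> tangent S" "v' \<in> tangent S" "w \<in> tangent S" for v v' w
    using lin(2)[of v v' w] that by (simp add: alternating_form_def)
  have scale1: "alternating_form H (r *\<^sub>R v) w = r * alternating_form H v w"
    if "v \<in> tangent S" "w \<in> tangent S" for r v w
    using lin(3)[of v w "of_real r"] that by (simp add: alternating_form_def scaleR_eq_vector_smult)
  have add2: "alternating_form H v (w + w') = alternating_form H v w + alternating_form H v w'"
    if "v \<in> tangent S" "w \<in> tangent S" "w' \<in> tangent S" for v w w'
    using lin(6)[of v w w'] that by (simp add: alternating_form_def)
  show "alternating_form H v (r *\<^sub>R w) = r * alternating_form H v w"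
    using lin(7)[of v w "of_real r"] v w by (simp add: alternating_form_def scaleR_eq_vector_smult)
  show "alternating_form H (v - v') w = alternating_form H v w - alternating_form H v' w"
    if "v' \<in> tangent S"
    using add1[of "v - v'" v' w] that v w tangent_closed(4)[OF S] by simp
  show "alternating_form H v (w - w') = alternating_form H v w - alternating_form H v w'"
    if "w' \<in> tangent S"
    using add2[of v "w - w'" w'] that v w tangent_closed(4)[OF S] by simp
  show "v' \<in> tangent S \<Longrightarrow> alternating_form H (v + v') w = alternating_form H v w + alternating_form H v' w"
    by (rule add1[OF v _ w])
  show "alternating_form H (r *\<^sub>R v) w = r * alternating_form H v w" by (rule scale1[OF v w])
  show "w' \<in> tangent S \<Longrightarrow> alternating_form H v (w + w') = alternating_form H v w + alternating_form H v w'"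
    by (rule add2[OF v w])
qed

text \<open>
  The test vector \<open>\<i> v\<close> turns the imaginary part into the positive real part.
\<close>

lemma alternating_form_nondegenerate:
  assumes S: "complex_torus S" and H: "polarization S H" and v: "v \<in> tangent S"
    and orth: "\<And>w. w \<in> tangent S \<Longrightarrow> alternating_form H v w = 0"
  shows "v = 0"
proof (rule ccontr)
  assume "v \<noteq> 0"
  then have "Re (H v v) > 0" using polarization_linear(5)[OF S H v] by simp
  moreover have "H v (\<i> *s v) = - \<i> * H v v" using polarization_linear(7)[OF S H v v, of \<i>] by simp
  moreover have "Im (H v (\<i> *s v)) = 0"
    using orth[OF tangent_closed(5)[OF S v]] by (simp add: alternating_form_def)
  ultimately show False by simp
qed

lemma finite_basis_of_lattice_span:
  fixes S :: "'n::finite ctorus"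
  assumes S: "complex_torus S"
  obtains F where "finite F" "F \<subseteq> lattice S" "independent F" "span F = tangent S"
proof -
  obtain F where F: "F \<subseteq> lattice S" "independent F" "lattice S \<subseteq> span F"
    using maximal_independent_subset .
  have "span F = tangent S"
    using F(1,3) unfolding span_lattice[OF S, symmetric]
    by (metis span_mono span_span subset_antisym)
  then show ?thesis using that F independent_imp_finite[OF F(2)] by blast
qed

text \<open>
  Forms and analytic representations are only linear on a tangent space and vanish outside. This
  replaces them by maps that are linear on the whole ambient space, to which linear algebra applies.
\<close>

lemma linear_extension_from_subspace:
  fixes f :: "'a::real_vector \<Rightarrow> 'b::real_vector"
  assumes V: "subspace V"
    and add: "\<And>v w. v \<in> V \<Longrightarrow> w \<in> V \<Longrightarrow> f (v + w) = f v + f w"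
    and scale: "\<And>r v. v \<in> V \<Longrightarrow> f (r *\<^sub>R v) = r *\<^sub>R f v"
  obtains g where "linear g" "\<And>v. v \<in> V \<Longrightarrow> g v = f v"
proof -
  obtain B where B: "B \<subseteq> V" "independent B" "V \<subseteq> span B"
    using maximal_independent_subset .
  obtain g where g: "linear g" "\<forall>b\<in>B. g b = f b"
    using linear_independent_extend[OF B(2), of f] by blast
  have "v \<in> V \<and> g v = f v" if "v \<in> span B" for v
    using that
  proof (induction rule: span_induct_alt)
    case base
    have "f 0 = 0" using scale[of 0 0] subspace_0[OF V] by simp
    then show ?case using subspace_0[OF V] linear_0[OF g(1)] by simp
  next
    case (step c x y)
    then have "x \<in> V" "c *\<^sub>R x \<in> V" using B(1) subspace_scale[OF V] by auto
    then show ?case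
      using step g add scale subspace_add[OF V] by (simp add: linear_add linear_scale)
  qed
  then show ?thesis using that g(1) B(3) by blast
qed

lemma alternating_form_functional:
  assumes S: "complex_torus S" and H: "polarization S H" and v: "v \<in> tangent S"
  obtains g where "linear g" "\<And>w. w \<in> tangent S \<Longrightarrow> g w = alternating_form H v w"
  by (rule linear_extension_from_subspace[OF subspace_tangent[OF S], of "alternating_form H v"])
     (use alternating_form_linear[OF S H v] in auto)

text \<open>
  Pairing with a basis \<open>F\<close> of \<open>V\<close> is an endomorphism \<open>v \<mapsto> (\<Sum>f\<in>F. E v f \<cdot> f)\<close> of \<open>V\<close>. It is injective by
  nondegeneracy, hence surjective, and a preimage of \<open>\<Sum>f\<in>F. g f \<cdot> f\<close> represents \<open>g\<close>.
\<close>

lemma alternating_form_represents: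
  assumes S: "complex_torus S" and H: "polarization S H" and g: "linear g"
  obtains v where "v \<in> tangent S" "\<And>w. w \<in> tangent S \<Longrightarrow> alternating_form H v w = g w"
proof -
  obtain F where F: "finite F" "F \<subseteq> lattice S" "independent F" "span F = tangent S"
    using finite_basis_of_lattice_span[OF S] .
  have FV: "f \<in> tangent S" if "f \<in> F" for f using F(2) lattice_closed(5)[OF S] that by blast
  have ext: "alternating_form H v w = h w"
    if v: "v \<in> tangent S" and h: "linear h" "\<And>f. f \<in> F \<Longrightarrow> alternating_form H v f = h f"
      and w: "w \<in> tangent S" for v h w
  proof -
    obtain e where e: "linear e" "\<And>w. w \<in> tangent S \<Longrightarrow> e w = alternating_form H v w"
      using alternating_form_functional[OF S H v] by blast
    have "e w = h w" by (rule linear_eq_on[OF e(1) h(1), of w F]) (use e(2) FV h(2) w F(4) in auto)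
    then show ?thesis using e(2)[OF w] by simp
  qed
  define T' where "T' v = (\<Sum>f\<in>F. alternating_form H v f *\<^sub>R f)" for v
  have T'_add: "T' (v + w) = T' v + T' w" if "v \<in> tangent S" "w \<in> tangent S" for v w
    using alternating_form_linear(1)[OF S H that(1) FV that(2)]
    by (simp add: T'_def scaleR_left_distrib sum.distrib)
  have T'_scale: "T' (r *\<^sub>R v) = r *\<^sub>R T' v" if "v \<in> tangent S" for r v
    using alternating_form_linear(3)[OF S H that FV] by (simp add: T'_def scaleR_sum_right)
  obtain T where T: "linear T" "\<And>v. v \<in> tangent S \<Longrightarrow> T v = T' v"
    using linear_extension_from_subspace[OF subspace_tangent[OF S] T'_add T'_scale] by blast
  have "inj_on T (tangent S)"
    unfolding linear_inj_on_iff_eq_0[OF T(1) subspace_tangent[OF S]]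
  proof (intro ballI impI)
    fix v assume v: "v \<in> tangent S" and "T v = 0"
    then have "(\<Sum>f\<in>F. alternating_form H v f *\<^sub>R f) = 0" using T(2) by (simp add: T'_def)
    then have "alternating_form H v f = 0" if "f \<in> F" for f
      using independentD[OF F(3,1), of "alternating_form H v"] that by simp
    then have "alternating_form H v w = 0" if "w \<in> tangent S" for w
      using ext[OF v linear_zero _ that] by simp
    then show "v = 0" by (rule alternating_form_nondegenerate[OF S H v])
  qed
  then have "dim (T ` tangent S) = dim (tangent S)"
    by (intro dim_image_eq[OF T(1)]) (simp add: span_eq_iff[THEN iffD2, OF subspace_tangent[OF S]])
  moreover have "T ` tangent S \<subseteq> tangent S"
    using T(2) tangent_scaleR[OF S FV] by (auto simp: T'_def intro!: subspace_sum[OF subspace_tangent[OF S]])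
  ultimately have surj: "T ` tangent S = tangent S"
    by (intro subspace_dim_equal linear_subspace_image[OF T(1)] subspace_tangent[OF S]) auto
  have "(\<Sum>f\<in>F. g f *\<^sub>R f) \<in> T ` tangent S"
    unfolding surj unfolding F(4)[symmetric] by (intro span_sum span_scale span_base)
  then obtain v where v: "v \<in> tangent S" and Tv: "(\<Sum>f\<in>F. g f *\<^sub>R f) = T v" by (elim imageE)
  have "(\<Sum>f\<in>F. (alternating_form H v f - g f) *\<^sub>R f) = T' v - (\<Sum>f\<in>F. g f *\<^sub>R f)"
    unfolding T'_def by (simp only: scaleR_left_diff_distrib sum_subtractf)
  also have "\<dots> = 0" unfolding Tv using T(2)[OF v] by simp
  finally have zero: "(\<Sum>f\<in>F. (alternating_form H v f - g f) *\<^sub>R f) = 0" .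
  have rep: "alternating_form H v f = g f" if f: "f \<in> F" for f
    using independentD[OF F(3,1) subset_refl zero f] by simp
  show ?thesis by (rule that[OF v ext[OF v g rep]])
qed

section \<open>Kernels of polarizations and analytic representations\<close>

text \<open>
  The lattice usually written \<open>\<Lambda>(L)\<close>, the preimage of \<open>K(L)\<close> in the tangent space.
\<close>

definition polar_lattice ::
  "'n::finite ctorus \<Rightarrow> (complex ^ 'n \<Rightarrow> complex ^ 'n \<Rightarrow> complex) \<Rightarrow> (complex ^ 'n) set" where
  "polar_lattice S H = {v \<in> tangent S. \<forall>m \<in> lattice S. alternating_form H v m \<in> \<int>}"

lemma dual_proj_eqD:
  assumes "dual_proj S k = dual_proj S l"
  shows "k - l \<in> dual_lattice S"
proof -
  have "k \<in> dual_proj S k"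
    unfolding dual_proj_eq by (rule image_eqI[OF _ dual_lattice_closed(1)]) simp
  then show ?thesis using assms by (auto simp: dual_proj_eq)
qed

lemma pol_kernel_eq_image_polar_lattice:
  assumes S: "complex_torus S" and H: "polarization S H"
  shows "pol_kernel S H = torus_proj S ` polar_lattice S H"
proof -
  have zero: "dual_proj S 0 = dual_lattice S" by (simp add: dual_proj_eq)
  have "H v \<in> dual_tangent S" if "v \<in> tangent S" for v
    using polarization_linear(1,6,7)[OF S H] that by (auto simp: dual_tangent_def)
  then have "H v \<in> dual_lattice S \<longleftrightarrow> v \<in> polar_lattice S H" if "v \<in> tangent S" for v
    using that by (simp add: dual_lattice_def polar_lattice_def alternating_form_def)
  moreover have "phi S H (torus_proj S v) = \<one>\<^bsub>dual_points S\<^esub> \<longleftrightarrow> H v \<in> dual_lattice S"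
    if "v \<in> tangent S" for v
    using phi_torus_proj[OF S H that] zero dual_proj_eqD[of S "H v" 0] dual_proj_add_lattice[of "H v" S 0]
    by (auto simp: dual_points_def)
  ultimately have "phi S H (torus_proj S v) = \<one>\<^bsub>dual_points S\<^esub> \<longleftrightarrow> v \<in> polar_lattice S H"
    if "v \<in> tangent S" for v
    using that by blast
  moreover have "polar_lattice S H \<subseteq> tangent S" by (auto simp: polar_lattice_def)
  ultimately show ?thesis by (auto simp: pol_kernel_def kernel_def carrier_points)
qed

lemma is_analytic_repD:
  assumes "is_analytic_rep S T f U" and v: "v \<in> tangent S"
  shows "w \<in> tangent S \<Longrightarrow> U (v + w) = U v + U w"
    and "U (c *s v) = c *s U v"
    and "U (r *\<^sub>R v) = r *\<^sub>R U v"
    and "U v \<in> tangent T"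
    and "f (torus_proj S v) = torus_proj T (U v)"
  using assms by (simp_all add: is_analytic_rep_def scaleR_eq_vector_smult)

lemma is_analytic_rep_diff:
  assumes S: "complex_torus S" and U: "is_analytic_rep S T f U"
    and v: "v \<in> tangent S" and w: "w \<in> tangent S"
  shows "U (v - w) = U v - U w"
proof -
  have "U (v - w) + U w = U v"
    using is_analytic_repD(1)[OF U tangent_closed(4)[OF S v w] w] by simp
  then show ?thesis by (simp add: algebra_simps)
qed

text \<open>
  The intertwining relation says that the defect of adjointness is integral on \<open>\<Lambda>\<close> for every \<open>v\<close>.
  It scales with \<open>v\<close>, and a real number with all real multiples integral is zero.
\<close>

lemma adjoint_if_intertwines_phi:
  assumes S: "complex_torus S" and H: "polarization S H" and u: "u \<in> torus_End S"
    and comm: "\<And>x. x \<in> carrier (points S) \<Longrightarrow> phi S H (u x) = dual_hom S S u (phi S H x)"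
    and v: "v \<in> tangent S" and w: "w \<in> tangent S"
  shows "alternating_form H (analytic_rep S S u v) w = alternating_form H v (analytic_rep S S u w)"
proof -
  define U where "U = analytic_rep S S u"
  have U: "is_analytic_rep S S u U"
    unfolding U_def by (rule is_analytic_rep_analytic_rep[OF S S u])
  note UD = is_analytic_repD[OF U]
  define d where "d v m = alternating_form H (U v) m - alternating_form H v (U m)" for v m
  have int: "d v m \<in> \<int>" if v: "v \<in> tangent S" and m: "m \<in> lattice S" for v m
  proof -
    have "dual_proj S (H (U v)) = phi S H (u (torus_proj S v))"
      using phi_torus_proj[OF S H UD(4)[OF v]] UD(5)[OF v] by simp
    also have "\<dots> = dual_proj S (H v \<circ> U)"
      using comm[of "torus_proj S v"] v
      by (simp add: carrier_points phi_torus_proj[OF S H] dual_hom_dual_proj[OF S S u] U_def)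
    finally have "H (U v) - (H v \<circ> U) \<in> dual_lattice S" by (rule dual_proj_eqD)
    then show ?thesis using m by (auto simp: dual_lattice_def d_def alternating_form_def)
  qed
  have zero: "d v m = 0" if m: "m \<in> lattice S" for m
  proof (rule ccontr)
    assume "d v m \<noteq> 0"
    have mV: "m \<in> tangent S" by (rule lattice_closed(5)[OF S m])
    have "d (r *\<^sub>R v) m = r * d v m" for r
      using UD(3)[OF v] alternating_form_linear(3)[OF S H UD(4)[OF v] mV]
        alternating_form_linear(3)[OF S H v UD(4)[OF mV]]
      by (simp add: d_def right_diff_distrib)
    \<comment> \<open>The multiple of \<open>v\<close> is chosen so that the defect becomes \<open>1 / 2\<close>.\<close>
    then have "1 / 2 = d ((1 / (2 * d v m)) *\<^sub>R v) m" using \<open>d v m \<noteq> 0\<close> by simp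
    also have "\<dots> \<in> \<int>" by (rule int[OF tangent_scaleR[OF S v] m])
    finally show False by simp
  qed
  have "d v w = 0"
    using S w
  proof (induction rule: tangent_induct)
    case zero
    have "U 0 = 0" using UD(3)[OF v, of 0] by simp
    then show ?case
      using alternating_form_linear(6)[OF S H v v, of 0]
        alternating_form_linear(6)[OF S H UD(4)[OF v] v, of 0] by (simp add: d_def)
  next
    case (step c l w)
    have l: "l \<in> tangent S" by (rule lattice_closed(5)[OF S step(1)])
    note cl = tangent_scaleR[OF S l, of c]
    show ?case
      using zero[OF step(1)] step(3) alternating_form_linear(4)[OF S H UD(4)[OF v] cl step(2)]
        alternating_form_linear(6)[OF S H UD(4)[OF v] l, of c] UD(1)[OF cl step(2)] UD(3)[OF l]
        alternating_form_linear(4)[OF S H v tangent_scaleR[OF S UD(4)[OF l]] UD(4)[OF step(2)]]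
        alternating_form_linear(6)[OF S H v UD(4)[OF l], of c]
      by (simp add: d_def)
  qed
  then show ?thesis by (simp add: d_def U_def)
qed

lemma group_points: "complex_torus S \<Longrightarrow> group (points S)"
  unfolding points_def by (rule normal.factorgroup_is_group[OF lattice_normal])

lemma one_points: "complex_torus S \<Longrightarrow> \<one>\<^bsub>points S\<^esub> = torus_proj S 0"
  by (simp add: points_def torus_proj_eq)

lemma points_pow:
  assumes S: "complex_torus S" and v: "v \<in> tangent S"
  shows "torus_proj S v [^]\<^bsub>points S\<^esub> n = torus_proj S (real n *\<^sub>R v)"
proof -
  interpret group "points S" by (rule group_points[OF S])
  show ?thesis
  proof (induction n)
    case 0
    then show ?case by (simp add: one_points[OF S])
  next
    case (Suc n)
    then show ?case
      using points_mult[OF S tangent_scaleR[OF S v] v] by (simp add: algebra_simps)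
  qed
qed

lemma points_inv:
  assumes S: "complex_torus S" and v: "v \<in> tangent S"
  shows "inv\<^bsub>points S\<^esub> torus_proj S v = torus_proj S (- v)"
proof -
  interpret group "points S" by (rule group_points[OF S])
  show ?thesis
    by (rule inv_equality)
       (use points_mult[OF S tangent_closed(3)[OF S v] v] v tangent_closed(3)[OF S v] in
         \<open>auto simp: one_points[OF S] carrier_points\<close>)
qed

lemma scaleR_vector_smult_commute: "r *\<^sub>R (c *s v) = c *s (r *\<^sub>R (v :: complex ^ 'n))"
  by (simp add: scaleR_eq_vector_smult mult.commute)

lemma is_analytic_rep_nat_minus:
  assumes S: "complex_torus S" and U: "is_analytic_rep S S u U"
  shows "is_analytic_rep S S (nat_minus S q u) (\<lambda>v. if v \<in> tangent S then real q *\<^sub>R v - U v else 0)"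
proof -
  note UD = is_analytic_repD[OF U]
  have "nat_minus S q u (torus_proj S v) = torus_proj S (real q *\<^sub>R v - U v)" if v: "v \<in> tangent S" for v
    unfolding nat_minus_def points_pow[OF S v] UD(5)[OF v] points_inv[OF S UD(4)[OF v]]
    using points_mult[OF S tangent_scaleR[OF S v] tangent_closed(3)[OF S UD(4)[OF v]]] by simp
  then show ?thesis
    using UD tangent_closed[OF S] tangent_scaleR[OF S]
    by (simp add: is_analytic_rep_def scaleR_right_distrib vector_ssub_ldistrib scaleR_vector_smult_commute)
qed

text \<open>
  Both sides are analytic representations of \<open>u \<circ> u\<close>, which has only one.
\<close>

lemma analytic_rep_quadratic:
  assumes S: "complex_torus S" and U: "is_analytic_rep S S u U"
    and quad: "\<And>x. x \<in> carrier (points S) \<Longrightarrow> u (u x) = u x [^]\<^bsub>points S\<^esub> q"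
    and v: "v \<in> tangent S"
  shows "U (U v) = real q *\<^sub>R U v"
proof -
  note UD = is_analytic_repD[OF U]
  have out: "U v = 0" if "v \<notin> tangent S" for v using U that by (simp add: is_analytic_rep_def)
  have U0: "U 0 = 0" using UD(3)[OF v, of 0] by simp
  have "is_analytic_rep S S (u \<circ> u) (\<lambda>v. U (U v))"
    using UD out U0 by (simp add: is_analytic_rep_def)
  moreover have "(u \<circ> u) (torus_proj S v) = torus_proj S (real q *\<^sub>R U v)" if v: "v \<in> tangent S" for v
    using quad[of "torus_proj S v"] v points_pow[OF S UD(4)[OF v]] UD(5)[OF v] by (simp add: carrier_points)
  then have "is_analytic_rep S S (u \<circ> u) (\<lambda>v. real q *\<^sub>R U v)"
    using UD out tangent_scaleR[OF S] by (simp add: scaleR_vector_smult_commute is_analytic_rep_def scaleR_right_distrib)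
  ultimately have "(\<lambda>v. U (U v)) = (\<lambda>v. real q *\<^sub>R U v)" by (rule is_analytic_rep_unique[OF S S])
  then show ?thesis by (rule fun_cong)
qed

section \<open>Images of endomorphisms\<close>

lemma torus_incl_torus_proj:
  assumes S: "complex_torus S" and A: "subtorus A S"
  shows "torus_incl S (torus_proj A a) = torus_proj S a"
proof (intro subset_antisym subsetI)
  have lat: "lattice A \<subseteq> lattice S" and tA: "complex_torus A" using A by (auto simp: subtorus_def)
  show "x \<in> torus_proj S a" if x: "x \<in> torus_incl S (torus_proj A a)" for x
  proof -
    obtain l m where "l \<in> lattice S" "m \<in> lattice A" "x = l + (m + a)"
      using x by (auto simp: torus_incl_def set_mult_def torus_proj_eq)
    then show ?thesis
      unfolding torus_proj_eq using lat lattice_closed(2)[OF S]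
      by (intro image_eqI[of _ _ "l + m"]) (auto simp: add.assoc)
  qed
  show "x \<in> torus_incl S (torus_proj A a)" if "x \<in> torus_proj S a" for x
    using that lattice_closed(1)[OF tA] by (force simp: torus_incl_def set_mult_def torus_proj_eq)
qed

text \<open>
  Equality of the sets of points gives equality of the tangent spaces modulo the lattice, and two
  subspaces that agree modulo a countable group coincide.
\<close>

lemma tangent_image_torus:
  assumes S: "complex_torus S" and U: "is_analytic_rep S S f U" and A: "is_image_torus A S f"
  shows "tangent A = U ` tangent S"
proof
  note UD = is_analytic_repD[OF U]
  interpret discrete_subgroup "lattice S" by (rule discrete_subgroup_lattice[OF S])
  have sub: "subtorus A S" and tA: "complex_torus A" using A by (auto simp: is_image_torus_def subtorus_def)
  have "torus_proj S ` tangent A = f ` torus_proj S ` tangent S"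
    using A by (simp add: is_image_torus_def carrier_points image_image torus_incl_torus_proj[OF S sub])
  also have "\<dots> = torus_proj S ` U ` tangent S"
    unfolding image_image by (intro image_cong refl UD(5))
  finally have eq: "torus_proj S ` tangent A = torus_proj S ` U ` tangent S" .
  have cover: "\<exists>w\<in>W. v - w \<in> lattice S"
    if "torus_proj S ` V = torus_proj S ` W" "v \<in> V" for V W v
    using that torus_proj_eq_iff[OF S] by (metis image_iff)
  obtain g where g: "linear g" "\<And>v. v \<in> tangent S \<Longrightarrow> g v = U v"
    using linear_extension_from_subspace[OF subspace_tangent[OF S], of U] UD(1,3) by metis
  have img: "subspace (U ` tangent S)"
    using linear_subspace_image[OF g(1) subspace_tangent[OF S]] g(2) by simp
  show "tangent A \<subseteq> U ` tangent S"
    by (rule subspace_subset_if_subset_translates[OF subspace_tangent[OF tA] img cover[OF eq]])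
  show "U ` tangent S \<subseteq> tangent A"
    by (rule subspace_subset_if_subset_translates[OF img subspace_tangent[OF tA] cover[OF eq[symmetric]]])
qed

text \<open>
  The common form of both parts: \<open>U\<close> maps the polar lattice of \<open>L\<close> onto that of \<open>M\<close>. One inclusion is
  the identity \<open>E\<^sub>M (U v) a = E v a\<close>; the other one corrects a preimage \<open>b\<close> of \<open>a\<close> to a preimage \<open>v\<close>
  that is integral on the whole period lattice.
\<close>

lemma pol_kernel_of_root_on_image:
  assumes S: "complex_torus S" and L: "polarization S L"
    and U: "is_analytic_rep S S f U"
    and adj: "\<And>v w. v \<in> tangent S \<Longrightarrow> w \<in> tangent S \<Longrightarrow>
                alternating_form L (U v) w = alternating_form L v (U w)"
    and quad: "\<And>v. v \<in> tangent S \<Longrightarrow> U (U v) = real q *\<^sub>R U v"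
    and q: "q > 0"
    and A: "is_image_torus A S f"
    and M: "polarization A M" and root: "pol_restrict L A = pol_power M q"
  shows "torus_incl S ` pol_kernel A M = f ` pol_kernel S L"
proof -
  note UD = is_analytic_repD[OF U]
  interpret discrete_subgroup "lattice S" by (rule discrete_subgroup_lattice[OF S])
  have sub: "subtorus A S" and tA: "complex_torus A" using A by (auto simp: is_image_torus_def subtorus_def)
  have latA: "lattice A = lattice S \<inter> tangent A" using sub by (simp add: subtorus_def)
  have tan: "tangent A = U ` tangent S" by (rule tangent_image_torus[OF S U A])
  have AS: "a \<in> tangent S" if "a \<in> tangent A" for a using that UD(4) by (auto simp: tan)
  have U_tanA: "U a = real q *\<^sub>R a" if "a \<in> tangent A" for a
    using that quad by (auto simp: tan)
  have form_root: "alternating_form L a b = real q * alternating_form M a b"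
    if "a \<in> tangent A" "b \<in> tangent A" for a b
    using fun_cong[OF fun_cong[OF root, of a], of b] that
    by (simp add: pol_restrict_def pol_power_def alternating_form_def)
  have form_U: "alternating_form M (U v) a = alternating_form L v a"
    if v: "v \<in> tangent S" and a: "a \<in> tangent A" for v a
  proof -
    have "real q * alternating_form M (U v) a = alternating_form L (U v) a"
      using form_root[of "U v" a] v a by (simp add: tan)
    also have "\<dots> = real q * alternating_form L v a"
      using adj[OF v AS[OF a]] U_tanA[OF a] alternating_form_linear(6)[OF S L v AS[OF a]] by simp
    finally show ?thesis using q by simp
  qed
  \<comment> \<open>This holds already in the tangent space, before passing to cosets.\<close>
  have "polar_lattice A M = U ` polar_lattice S L"
  proof (intro subset_antisym subsetI)
    fix a assume "a \<in> U ` polar_lattice S L"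
    then obtain v where v: "v \<in> tangent S" "\<forall>m\<in>lattice S. alternating_form L v m \<in> \<int>" "a = U v"
      by (auto simp: polar_lattice_def)
    then show "a \<in> polar_lattice A M"
      using form_U[OF v(1)] by (auto simp: polar_lattice_def latA tan)
  next
    fix a assume a: "a \<in> polar_lattice A M"
    then obtain b where b: "b \<in> tangent S" "a = U b" by (auto simp: polar_lattice_def tan)
    obtain C where C: "finite C" "C \<subseteq> lattice A" "span C = tangent A"
      using finite_basis_of_lattice_span[OF tA] by metis
    obtain F where F: "finite F" "F \<subseteq> lattice S" "span F = tangent S"
      using finite_basis_of_lattice_span[OF S] by metis
    obtain g where g: "linear g" "\<And>w. w \<in> tangent S \<Longrightarrow> g w = alternating_form L b w"
      using alternating_form_functional[OF S L b(1)] by blast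
    have "g x \<in> \<int>" if "x \<in> lattice S" "x \<in> span C" for x
    proof -
      have x: "x \<in> tangent A" using that(2) by (simp add: C(3))
      then have "alternating_form M a x \<in> \<int>" using a that(1) by (simp add: polar_lattice_def latA)
      then show ?thesis using form_U[OF b(1) x] b(2) g(2)[OF AS[OF x]] by simp
    qed
    then obtain h where h: "linear h" "\<forall>x\<in>tangent A. h x = g x"
        "\<forall>x\<in>lattice S \<inter> span (F \<union> C). h x \<in> \<int>"
      using extend_integral_functional[OF C(1) _ F(1,2) g(1)] C(2) by (auto simp: C(3) latA)
    obtain v where v: "v \<in> tangent S" "\<And>w. w \<in> tangent S \<Longrightarrow> alternating_form L v w = h w"
      using alternating_form_represents[OF S L h(1)] by blast
    have "alternating_form L v m \<in> \<int>" if "m \<in> lattice S" for m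
      using v(2)[OF lattice_closed(5)[OF S that]] h(3) that span_mono[of F "F \<union> C"]
        lattice_closed(5)[OF S that] F(3) by auto
    then have "v \<in> polar_lattice S L" using v(1) by (simp add: polar_lattice_def)
    moreover have "U (v - b) = 0"
    proof (rule alternating_form_nondegenerate[OF S L])
      show "U (v - b) \<in> tangent S" by (rule UD(4)[OF tangent_closed(4)[OF S v(1) b(1)]])
      fix w assume w: "w \<in> tangent S"
      then have Uw: "U w \<in> tangent A" by (simp add: tan)
      have "alternating_form L (U (v - b)) w = alternating_form L (v - b) (U w)"
        by (rule adj[OF tangent_closed(4)[OF S v(1) b(1)] w])
      also have "\<dots> = h (U w) - g (U w)"
        using alternating_form_linear(2)[OF S L v(1) AS[OF Uw] b(1)] v(2)[OF AS[OF Uw]] g(2)[OF AS[OF Uw]]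
        by simp
      finally show "alternating_form L (U (v - b)) w = 0" using h(2) Uw by simp
    qed
    then have "U v = a" using is_analytic_rep_diff[OF S U v(1) b(1)] b(2) by simp
    ultimately show "a \<in> U ` polar_lattice S L" by blast
  qed
  then have "torus_incl S ` pol_kernel A M = torus_proj S ` U ` polar_lattice S L"
    by (simp add: pol_kernel_eq_image_polar_lattice[OF tA M] image_image torus_incl_torus_proj[OF S sub])
  also have "\<dots> = f ` pol_kernel S L"
    unfolding pol_kernel_eq_image_polar_lattice[OF S L] image_image
    by (intro image_cong refl UD(5)[symmetric]) (simp add: polar_lattice_def)
  finally show ?thesis .
qed

theorem proposition2p10:
  fixes S A P :: "'n::finite ctorus"
    and L :: "complex ^ 'n \<Rightarrow> complex ^ 'n \<Rightarrow> complex"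
    and u :: "(complex ^ 'n) set \<Rightarrow> (complex ^ 'n) set"
    and q :: nat
  assumes "abelian_variety S"
    and "polarization S L"
    and "u \<in> torus_End S"
    and "\<forall>x \<in> carrier (points S). phi S L (u x) = dual_hom S S u (phi S L x)"
    and "q > 0"
    and "\<forall>x \<in> carrier (points S). u (u x) = u x [^]\<^bsub>points S\<^esub> q"
    and "is_image_torus A S u"
    and "is_image_torus P S (nat_minus S q u)"
  shows "(\<forall>M. polarization A M \<and> pol_restrict L A = pol_power M q \<longrightarrow>
            torus_incl S ` pol_kernel A M = u ` pol_kernel S L) \<and>
         (\<forall>N. polarization P N \<and> pol_restrict L P = pol_power N q \<longrightarrow>
            torus_incl S ` pol_kernel P N = nat_minus S q u ` pol_kernel S L)"
proof -
  have S: "complex_torus S" using assms(1) by (simp add: abelian_variety_def)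
  define U where "U = analytic_rep S S u"
  have U: "is_analytic_rep S S u U"
    unfolding U_def by (rule is_analytic_rep_analytic_rep[OF S S assms(3)])
  note UD = is_analytic_repD[OF U]
  have adj: "alternating_form L (U v) w = alternating_form L v (U w)"
    if "v \<in> tangent S" "w \<in> tangent S" for v w
    unfolding U_def by (rule adjoint_if_intertwines_phi[OF S assms(2,3) _ that]) (use assms(4) in blast)
  have quad: "U (U v) = real q *\<^sub>R U v" if "v \<in> tangent S" for v
    by (rule analytic_rep_quadratic[OF S U _ that]) (use assms(6) in blast)
  \<comment> \<open>The case \<open>q - u\<close>: its lift \<open>q - U\<close> is again self-adjoint, and
    \<open>(q - U)\<^sup>2 = q\<^sup>2 - 2 q U + q U = q (q - U)\<close>.\<close>
  define U' where "U' v = (if v \<in> tangent S then real q *\<^sub>R v - U v else 0)" for v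
  have U': "is_analytic_rep S S (nat_minus S q u) U'"
    unfolding U'_def[abs_def] by (rule is_analytic_rep_nat_minus[OF S U])
  have adj': "alternating_form L (U' v) w = alternating_form L v (U' w)"
    if "v \<in> tangent S" "w \<in> tangent S" for v w
    using alternating_form_linear(2)[OF S assms(2) tangent_scaleR[OF S that(1)] that(2) UD(4)[OF that(1)]]
      alternating_form_linear(3)[OF S assms(2) that]
      alternating_form_linear(5)[OF S assms(2) that(1) tangent_scaleR[OF S that(2)] UD(4)[OF that(2)]]
      alternating_form_linear(6)[OF S assms(2) that] adj[OF that] that
    by (simp add: U'_def)
  have quad': "U' (U' v) = real q *\<^sub>R U' v" if v: "v \<in> tangent S" for v
  proof -
    have "U' v \<in> tangent S" by (rule is_analytic_repD(4)[OF U' v])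
    moreover have "U (real q *\<^sub>R v - U v) = 0"
      using is_analytic_rep_diff[OF S U tangent_scaleR[OF S v] UD(4)[OF v]] UD(3)[OF v] quad[OF v] by simp
    ultimately show ?thesis using v by (simp add: U'_def)
  qed
  show ?thesis
  proof (intro conjI allI impI; elim conjE)
    show "torus_incl S ` pol_kernel A M = u ` pol_kernel S L"
      if "polarization A M" "pol_restrict L A = pol_power M q" for M
      by (rule pol_kernel_of_root_on_image[OF S assms(2) U _ _ assms(5,7) that], fact adj, fact quad)
    show "torus_incl S ` pol_kernel P N = nat_minus S q u ` pol_kernel S L"
      if "polarization P N" "pol_restrict L P = pol_power N q" for N
      by (rule pol_kernel_of_root_on_image[OF S assms(2) U' _ _ assms(5,8) that], fact adj', fact quad')
  qed
qed

end
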